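(* Let $p\ge 1$ and $\rho^{ini}\in\mathcal{P}_p(\mathbb{R}^d)$. Let $a\in L^\infty([0,\infty);L^\infty(\mathbb{R}^d))^d$ satisfy the one-sided Lipschitz condition $$\langle a(t,x)-a(t,y),x-y\rangle\le \alpha(t)|x-y|^2,$$ with $\alpha\in L^1_{loc}([0,+\infty))$. Let $\rho(t)=Z(t)_\#\rho^{ini}$, $t\ge 0$, be the unique measure solution, in the sense of Poupaud and Rascle, of $\partial_t\rho+\mathrm{div}(a\rho)=0$ with $\rho(0,\cdot)=\rho^{ini}$, where $Z$ is the Filippov flow of $a$. Let $(\rho^n_J)_{n\in\mathbb{N},J\in\mathbb{Z}^d}$ be given by the upwind scheme, with time step $\Delta t>0$, space steps $\Delta x_1,\dots,\Delta x_d>0$ and $\Delta x=\max_i\Delta x_i\le 1$, initialized by $\rho^0_J=\rho^{ini}(C_J)$, and let $\rho^n_{\Delta x}=\sum_{J\in\mathbb{Z}^d}\rho^n_J\,\delta_{x_J}$. Assume that the CFL condition $$a_\infty\sum_{i=1}^d\frac{\Delta t}{\Delta x_i}\le 1$$ holds. Then there exists a non-negative constant $C$, depending upon $p$, $\rho^{ini}$ and $a_\infty$ only, such that, for all $n\in\mathbb{N}^*$, $$W_p\bigl(\rho(t^n),\rho^n_{\Delta x}\bigr)\le C\,e^{2\int_0^{t^n}\alpha(s)\,ds}\,\bigl(\sqrt{t^n\Delta x}+\Delta x\bigr).$$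
   Context: Notation. $\langle\cdot,\cdot\rangle$ and $|\cdot|$ are the Euclidean scalar product and norm on $\mathbb{R}^d$; $\mathcal{P}_p(\mathbb{R}^d)$ is the set of Borel probability measures on $\mathbb{R}^d$ with finite $p$-th moment; $W_p$ is the Wasserstein distance of order $p$ on $\mathcal{P}_p(\mathbb{R}^d)$; $Z_\#\mu$ is the pushforward of $\mu$ by $Z$; $\mathbb{N}^*=\{1,2,\dots\}$; $x^+=\max\{0,x\}$ and $x^-=\max\{0,-x\}$ for real $x$. $a_\infty$ is the $L^\infty$ norm of $a$ on $[0,+\infty)\times\mathbb{R}^d$. The function $\alpha$ is non-negative. Representative. $a=(a_1,\dots,a_d)$ denotes a fixed representative which is defined everywhere, jointly measurable in time and space, and satisfies the one-sided Lipschitz condition for all $t\ge 0$, $x,y\in\mathbb{R}^d$. Filippov flow. For $x\in\mathbb{R}^d$, $t\mapsto Z(t,x)$ is the (unique, under the one-sided Lipschitz condition) continuous function on $[0,\infty)$ such that $Z(0,x)=x$, $\partial_tZ(t,x)$ exists for a.e. $t\ge0$, and $\partial_t Z(t,x)\in\{\mathrm{Convess}(a)(t,\cdot)\}(Z(t,x))$ for a.e. $t\ge 0$, where $\{\mathrm{Convess}(a)(t,\cdot)\}(x)=\bigcap_{r>0}\bigcap_{N}\mathrm{Conv}[a(t,B(x,r)\setminus N)]$, $N$ ranges over Lebesgue null sets, and $\mathrm{Conv}$ is the closed convex hull. $Z(t)$ denotes the map $Z(t,\cdot)$. The measure solution of $\partial_t\rho+\mathrm{div}(a\rho)=0$, $\rho(0)=\rho^{ini}$,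 in the sense of Poupaud and Rascle is by definition $\rho(t)=Z(t)_\#\rho^{ini}$. Upwind scheme. $t^n=n\Delta t$; $(e_i)$ is the canonical basis of $\mathbb{R}^d$; for $J=(J_1,\dots,J_d)\in\mathbb{Z}^d$, $C_J=\prod_{i=1}^d[(J_i-\frac12)\Delta x_i,(J_i+\frac12)\Delta x_i)$ and $x_J=(J_1\Delta x_1,\dots,J_d\Delta x_d)$. With ${a_i}^n_J=\frac1{\Delta t}\int_{t^n}^{t^{n+1}}a_i(s,x_J)\,ds$, the scheme is $$\rho_J^{n+1}=\rho_J^n-\sum_{i=1}^d\frac{\Delta t}{\Delta x_i}\Big(({a_i}^n_J)^+\rho^n_J-({a_i}^n_{J+e_i})^-\rho^n_{J+e_i}-({a_i}^n_{J-e_i})^+\rho^n_{J-e_i}+({a_i}^n_J)^-\rho^n_J\Big),\quad n\in\mathbb{N},\ J\in\mathbb{Z}^d.$$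
   Formalization: The Filippov flow Z(·,x) is additionally required to be locally absolutely continuous in time; with mere continuity and an a.e. derivative it is not unique (for a=0 a Cantor-function translation also qualifies) and the bound would fail. *)

theory Defs
  imports "HOL-Probability.Probability" "HOL-Probability.Essential_Supremum"
begin

section \<open>Wasserstein distance\<close>

definition finite_moment_measures :: "real \<Rightarrow> (real ^ 'd) measure set" where
  "finite_moment_measures p =
     {\<mu>. sets \<mu> = sets borel \<and> prob_space \<mu> \<and> integrable \<mu> (\<lambda>x. norm x powr p)}"

definition couplings :: "(real ^ 'd) measure \<Rightarrow> (real ^ 'd) measure \<Rightarrow> ((real ^ 'd) \<times> (real ^ 'd)) measure set" where
  "couplings \<mu> \<nu> =
     {\<gamma>. sets \<gamma> = sets (borel \<Otimes>\<^sub>M borel) \<and> distr \<gamma> borel fst = \<mu> \<and> distr \<gamma> borel snd = \<nu>}"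

text \<open>The distance takes values in \<open>[0, \<infinity>]\<close>; in particular it is \<open>\<infinity>\<close>, not a junk value, if there is
  no coupling (e.g. if the masses differ) or no coupling of finite cost.\<close>

definition wasserstein :: "real \<Rightarrow> (real ^ 'd) measure \<Rightarrow> (real ^ 'd) measure \<Rightarrow> ennreal" where
  "wasserstein p \<mu> \<nu> =
     (let c = (INF \<gamma>\<in>couplings \<mu> \<nu>. \<integral>\<^sup>+ z. ennreal (norm (fst z - snd z) powr p) \<partial>\<gamma>)
      in if c = \<top> then \<top> else ennreal (enn2real c powr (1 / p)))"

section \<open>Velocity fields\<close>

text \<open>Velocity fields are total functions on \<open>\<real> \<times> \<real>\<^sup>d\<close>, of which only the values at times \<open>t \<ge> 0\<close>
  are relevant.\<close>

abbreviation time_space :: "(real \<times> (real ^ 'd)) measure" where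
  "time_space \<equiv> lebesgue_on {0..} \<Otimes>\<^sub>M lebesgue"

definition jointly_measurable :: "(real \<Rightarrow> real ^ 'd \<Rightarrow> real ^ 'd) \<Rightarrow> bool" where
  "jointly_measurable a \<longleftrightarrow> (\<lambda>(t, x). a t x) \<in> time_space \<rightarrow>\<^sub>M borel"

definition Linf_norm :: "(real \<Rightarrow> real ^ 'd \<Rightarrow> real ^ 'd) \<Rightarrow> ereal" where
  "Linf_norm a = esssup time_space (\<lambda>(t, x). ereal (norm (a t x)))"

definition one_sided_Lipschitz :: "(real \<Rightarrow> real ^ 'd \<Rightarrow> real ^ 'd) \<Rightarrow> (real \<Rightarrow> real) \<Rightarrow> bool" where
  "one_sided_Lipschitz a \<alpha> \<longleftrightarrow>
     (\<forall>t\<ge>0. \<forall>x y. (a t x - a t y) \<bullet> (x - y) \<le> \<alpha> t * (norm (x - y))\<^sup>2)"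

definition L1_loc :: "(real \<Rightarrow> real) \<Rightarrow> bool" where
  "L1_loc \<alpha> \<longleftrightarrow> (\<forall>T\<ge>0. set_integrable lebesgue {0..T} \<alpha>)"

section \<open>Filippov flow\<close>

definition Convess :: "(real ^ 'd \<Rightarrow> real ^ 'd) \<Rightarrow> real ^ 'd \<Rightarrow> (real ^ 'd) set" where
  "Convess b x = (\<Inter>r\<in>{0<..}. \<Inter>N\<in>null_sets lebesgue. closure (convex hull (b ` (ball x r - N))))"

definition absolutely_continuous_on :: "real \<Rightarrow> real \<Rightarrow> (real \<Rightarrow> real ^ 'd) \<Rightarrow> bool" where
  "absolutely_continuous_on u v f \<longleftrightarrow>
     (\<forall>\<epsilon>>0. \<exists>\<delta>>0. \<forall>D S. D division_of S \<and> S \<subseteq> {u..v} \<and> (\<Sum>K\<in>D. Sup K - Inf K) < \<delta>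
        \<longrightarrow> (\<Sum>K\<in>D. norm (f (Sup K) - f (Inf K))) < \<epsilon>)"

text \<open>Solutions of the differential inclusion are understood in the sense of Carath\'eodory and
  Filippov, i.e. they are locally absolutely continuous in time. Without absolute continuity, a
  continuous function satisfying the inclusion almost everywhere would not be unique: for \<open>a = 0\<close>
  one could take the Cantor function.\<close>

definition Filippov_flow :: "(real \<Rightarrow> real ^ 'd \<Rightarrow> real ^ 'd) \<Rightarrow> (real \<Rightarrow> real ^ 'd \<Rightarrow> real ^ 'd) \<Rightarrow> bool" where
  "Filippov_flow a Z \<longleftrightarrow>
     (\<forall>x. Z 0 x = x
        \<and> continuous_on {0..} (\<lambda>t. Z t x)
        \<and> (\<forall>T\<ge>0. absolutely_continuous_on 0 T (\<lambda>t. Z t x))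
        \<and> (AE t in lebesgue. t \<ge> 0 \<longrightarrow>
             (\<exists>v \<in> Convess (a t) (Z t x). ((\<lambda>s. Z s x) has_vector_derivative v) (at t within {0..}))))"

text \<open>The measure solution of \<open>\<partial>\<^sub>t\<rho> + div(a\<rho>) = 0\<close>, \<open>\<rho>(0) = \<rho>\<^sup>i\<^sup>n\<^sup>i\<close>, in the sense of Poupaud and
  Rascle is by definition the pushforward of the initial datum by the Filippov flow \<open>Z\<close> of \<open>a\<close>.\<close>

definition Poupaud_Rascle_solution ::
  "(real \<Rightarrow> real ^ 'd \<Rightarrow> real ^ 'd) \<Rightarrow> (real ^ 'd) measure \<Rightarrow> real \<Rightarrow> (real ^ 'd) measure" where
  "Poupaud_Rascle_solution Z \<rho>ini t = distr \<rho>ini borel (Z t)"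

section \<open>Upwind scheme\<close>

text \<open>The vector \<open>dx\<close> collects the space steps \<open>\<Delta>x\<^sub>1, \<dots>, \<Delta>x\<^sub>d\<close>.\<close>

definition mesh_size :: "real ^ 'd \<Rightarrow> real" where
  "mesh_size dx = Max (range (\<lambda>i. dx $ i))"

definition grid_point :: "real ^ 'd \<Rightarrow> int ^ 'd \<Rightarrow> real ^ 'd" where
  "grid_point dx J = (\<chi> i. of_int (J $ i) * dx $ i)"

definition cell :: "real ^ 'd \<Rightarrow> int ^ 'd \<Rightarrow> (real ^ 'd) set" where
  "cell dx J = {x. \<forall>i. x $ i \<in> {(of_int (J $ i) - 1/2) * dx $ i ..< (of_int (J $ i) + 1/2) * dx $ i}}"

definition mean_velocity ::
  "(real \<Rightarrow> real ^ 'd \<Rightarrow> real ^ 'd) \<Rightarrow> real \<Rightarrow> real ^ 'd \<Rightarrow> nat \<Rightarrow> int ^ 'd \<Rightarrow> 'd \<Rightarrow> real" where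
  "mean_velocity a dt dx n J i =
     (1 / dt) * (LINT s:{real n * dt .. real (n + 1) * dt}|lebesgue. a s (grid_point dx J) $ i)"

definition pos_part :: "real \<Rightarrow> real" where
  "pos_part x = max 0 x"

definition neg_part :: "real \<Rightarrow> real" where
  "neg_part x = max 0 (- x)"

primrec upwind ::
  "(real \<Rightarrow> real ^ 'd \<Rightarrow> real ^ 'd) \<Rightarrow> real \<Rightarrow> real ^ 'd \<Rightarrow> (real ^ 'd) measure \<Rightarrow> nat \<Rightarrow> int ^ 'd \<Rightarrow> real" where
  "upwind a dt dx \<rho>ini 0 = (\<lambda>J. measure \<rho>ini (cell dx J))"
| "upwind a dt dx \<rho>ini (Suc n) = (\<lambda>J.
     upwind a dt dx \<rho>ini n J
     - (\<Sum>i\<in>UNIV. dt / dx $ i *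
          (pos_part (mean_velocity a dt dx n J i) * upwind a dt dx \<rho>ini n J
           - neg_part (mean_velocity a dt dx n (J + axis i 1) i) * upwind a dt dx \<rho>ini n (J + axis i 1)
           - pos_part (mean_velocity a dt dx n (J - axis i 1) i) * upwind a dt dx \<rho>ini n (J - axis i 1)
           + neg_part (mean_velocity a dt dx n J i) * upwind a dt dx \<rho>ini n J)))"

text \<open>The atomic measure \<open>\<Sum>\<^sub>J w\<^sub>J \<delta>\<^bsub>x\<^sub>J\<^esub>\<close>, as the pushforward under \<open>J \<mapsto> x\<^sub>J\<close> of the measure with
  weights \<open>w\<close> on the index set. Measures being non-negative, it is meaningful for non-negative
  weights only (\<open>ennreal\<close> maps negative reals to 0); the weights of the scheme are non-negative
  under the CFL condition.\<close>

definition atomic_measure :: "real ^ 'd \<Rightarrow> (int ^ 'd \<Rightarrow> real) \<Rightarrow> (real ^ 'd) measure" where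
  "atomic_measure dx w =
     distr (density (count_space UNIV) (\<lambda>J. ennreal (w J))) borel (grid_point dx)"

end

theory Submission
  imports Defs
begin

text \<open>
  The scheme is the forward equation of a random walk on the grid which, from \<open>x\<^sub>J\<close> at time \<open>t\<^sup>n\<close>, moves
  on average by \<open>\<integral> a(s, x\<^sub>J) ds\<close> over the time step. Running this walk from the grid point next to \<open>x\<close>
  and averaging over \<open>x\<close> couples the numerical measure with the law of \<open>Z(t\<^sup>n, x)\<close>. Let \<open>U\<close> be the squared
  distance between the walk and the flow plus \<open>\<Delta>x\<^sup>2\<close>. In one step the one-sided Lipschitz condition
  multiplies \<open>U\<close> by at most \<open>1 + 4\<integral>\<alpha>\<close>, up to an additive \<open>O(\<Delta>t \<Delta>x)\<close>; the added \<open>\<Delta>x\<^sup>2\<close> absorbs the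
  displacement of the flow during the step. The centred jumps have size \<open>O(\<Delta>x)\<close> and variance
  \<open>O(\<Delta>t \<Delta>x)\<close>, so that passing to the expectation of \<open>(U + r)^k\<close> again costs only
  \<open>r \<mapsto> r + O(\<Delta>t \<Delta>x)\<close>. Iterating bounds the \<open>2k\<close>-th moment of the distance, for any \<open>2k \<ge> p\<close>,
  uniformly in \<open>x\<close>.
\<close>

section \<open>Absolutely continuous curves\<close>

text \<open>The essential bound on the velocity says nothing about single points, yet the scheme
  samples it exactly on the grid, a null set. The one-sided Lipschitz condition upgrades the bound
  to every point, at almost every time, so that grid velocities and Filippov velocities share the
  bound \<open>L\<close>. The same condition makes the flow Lipschitz in \<open>x\<close>, hence
  measurable, which gives the pushforward its meaning.

  The integral of \<alpha> over a step may be large, so nothing is expanded in it. The condition is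
  applied to the separation at an intermediate time; its square is at most twice the initial squared
  separation plus twice the squared displacement. This doubles the rate 2\<alpha> of a squared
  distance to 4\<alpha>, and the final square root leaves the exponent 2 of the theorem.

  Even moments are chosen because powers of a squared distance have a second-order expansion in the
  jump, in which the part linear in a centred jump averages out. Order p is recovered from s^p \<le>
  1 + s^(2k), at the scale where the moment of order 2k is at most 1.\<close>

lemma inj_on_snd_tagged_division_real:
  assumes p: "p tagged_division_of {a..b::real}"
  shows "inj_on snd p"
proof (rule inj_onI, clarsimp)
  fix x y K assume xy: "(x, K) \<in> p" "(y, K) \<in> p"
  have "x \<in> K" "y \<in> K" using tagged_division_ofD(2)[OF p xy(1)] tagged_division_ofD(2)[OF p xy(2)] by simp_all
  obtain u v where K: "K = cbox u v" using assms xy by (metis tagged_division_ofD(4))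
  show "x = y"
  proof (rule ccontr)
    assume "x \<noteq> y"
    then have "interior K \<inter> interior K = {}" using tagged_division_ofD(5)[OF assms xy] by auto
    then have "box u v = {}" by (simp add: K interior_cbox)
    then have "u \<ge> v" by auto
    then show False using K \<open>x \<in> K\<close> \<open>y \<in> K\<close> \<open>x \<noteq> y\<close> by auto
  qed
qed

text \<open>The straddle estimate of gauge integration. Both endpoints are compared with
  \<open>x\<close>; as \<open>x\<close> lies between them, the two errors add up to a multiple of
  \<open>v - u\<close>.\<close>

lemma straddle_vector_derivative:
  fixes f :: "real \<Rightarrow> 'a::real_normed_vector"
  assumes "(f has_vector_derivative f') (at x within S)" "e > 0"
  shows "\<exists>d>0. \<forall>u v. u \<in> S \<and> v \<in> S \<and> u \<le> x \<and> x \<le> v \<and> u \<in> ball x d \<and> v \<in> ball x d \<longrightarrow>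
           norm ((v - u) *\<^sub>R f' - (f v - f u)) \<le> e * (v - u)"
proof -
  obtain d where d: "d > 0" "\<And>y. y \<in> S \<Longrightarrow> norm (y - x) < d \<Longrightarrow>
      norm (f y - f x - (y - x) *\<^sub>R f') \<le> e * norm (y - x)"
    using assms unfolding has_vector_derivative_def has_derivative_within_alt by metis
  have "norm ((v - u) *\<^sub>R f' - (f v - f u)) \<le> e * (v - u)"
    if "u \<in> S" "v \<in> S" "u \<le> x" "x \<le> v" "u \<in> ball x d" "v \<in> ball x d" for u v
  proof -
    have "norm ((v - u) *\<^sub>R f' - (f v - f u)) =
        norm ((f u - f x - (u - x) *\<^sub>R f') - (f v - f x - (v - x) *\<^sub>R f'))"
      by (simp add: algebra_simps)
    also have "\<dots> \<le> norm (f u - f x - (u - x) *\<^sub>R f') + norm (f v - f x - (v - x) *\<^sub>R f')"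
      by (rule norm_triangle_ineq4)
    also have "\<dots> \<le> e * norm (u - x) + e * norm (v - x)"
      using that by (intro add_mono d) (auto simp: dist_real_def)
    also have "\<dots> = e * (v - u)" using that by (simp add: algebra_simps)
    finally show ?thesis .
  qed
  then show ?thesis using d(1) by blast
qed

text \<open>The fundamental theorem of calculus, proved directly with gauges. At tags outside
  \<open>N\<close> the gauge comes from the straddle estimate. At tags in \<open>N\<close> it
  confines the intervals to an open set of measure below the \<delta> of absolute continuity, which
  bounds the increments there. Integrability of the derivative comes out as part of the
  conclusion.\<close>

lemma has_integral_of_absolutely_continuous:
  fixes f :: "real \<Rightarrow> real ^ 'd"
  assumes ab: "a \<le> b" and ac: "absolutely_continuous_on a b f" and N: "negligible N"
    and deriv: "\<And>x. x \<in> {a..b} - N \<Longrightarrow> (f has_vector_derivative f' x) (at x within {a..b})"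
  shows "(f' has_integral (f b - f a)) {a..b}"
proof -
  \<comment> \<open>With value 0 on \<open>N\<close>, pairs tagged there contribute only the
    increments of \<open>f\<close>.\<close>
  define g where "g x = (if x \<in> N then 0 else f' x)" for x
  have "(g has_integral (f b - f a)) (cbox a b)"
    unfolding has_integral
  proof (intro allI impI)
    fix e :: real assume "e > 0"
    \<comment> \<open>The summand 1 keeps the denominator positive when
      \<open>a = b\<close>.\<close>
    define e1 where "e1 = e / (2 * (b - a + 1))"
    have e1: "e1 > 0" using \<open>e > 0\<close> ab by (simp add: e1_def)
    obtain \<delta> where \<delta>: "\<delta> > 0" "\<And>D S. D division_of S \<Longrightarrow> S \<subseteq> {a..b} \<Longrightarrow> (\<Sum>K\<in>D. Sup K - Inf K) < \<delta>
        \<Longrightarrow> (\<Sum>K\<in>D. norm (f (Sup K) - f (Inf K))) < e / 2"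
      using ac \<open>e > 0\<close> unfolding absolutely_continuous_on_def by (meson half_gt_zero)
    have "N \<in> null_sets lebesgue" using N by (simp add: negligible_iff_null_sets)
    then obtain U where U: "open U" "N \<subseteq> U" "U - N \<in> lmeasurable" "emeasure lebesgue (U - N) < ennreal \<delta>"
      using sets_lebesgue_outer_open[of N \<delta>] \<delta>(1) by auto
    have Um: "U \<in> sets lebesgue" using U(1) by simp
    have eU: "emeasure lebesgue U < ennreal \<delta>"
    proof -
      have "emeasure lebesgue U = emeasure lebesgue (U - N)"
        using \<open>N \<in> null_sets lebesgue\<close> Um by (simp add: emeasure_Diff_null_set)
      then show ?thesis using U(4) by simp
    qed
    have Ul: "U \<in> lmeasurable" using Um eU
      by (intro fmeasurableI) (auto simp: top.not_eq_extremum intro: less_trans)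
    have mU: "measure lebesgue U < \<delta>"
      using eU Ul \<delta>(1) by (simp add: emeasure_eq_measure2 ennreal_less_iff)
    have "\<exists>d>0. (x \<in> N \<longrightarrow> ball x d \<subseteq> U) \<and> (x \<in> {a..b} - N \<longrightarrow> (\<forall>u v. u \<in> {a..b} \<and> v \<in> {a..b} \<and> u \<le> x \<and> x \<le> v \<and> u \<in> ball x d \<and> v \<in> ball x d \<longrightarrow>
           norm ((v - u) *\<^sub>R f' x - (f v - f u)) \<le> e1 * (v - u)))" for x
    proof (cases "x \<in> N")
      case True then show ?thesis using U(1,2) openE by blast
    next
      case False then show ?thesis using straddle_vector_derivative[OF deriv e1, of x]
        by (cases "x \<in> {a..b}") (auto intro: exI[of _ "1::real"])
    qed
    then obtain d where d: "\<And>x. d x > 0" "\<And>x. x \<in> N \<Longrightarrow> ball x (d x) \<subseteq> U"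
      "\<And>x u v. x \<in> {a..b} - N \<Longrightarrow> u \<in> {a..b} \<and> v \<in> {a..b} \<and> u \<le> x \<and> x \<le> v \<and> u \<in> ball x (d x) \<and> v \<in> ball x (d x) \<Longrightarrow>
           norm ((v - u) *\<^sub>R f' x - (f v - f u)) \<le> e1 * (v - u)"
      by metis
    show "\<exists>\<gamma>. gauge \<gamma> \<and> (\<forall>\<D>. \<D> tagged_division_of cbox a b \<and> \<gamma> fine \<D> \<longrightarrow>
        norm ((\<Sum>(x,k)\<in>\<D>. measure lborel k *\<^sub>R g x) - (f b - f a)) < e)"
    proof (intro exI[of _ "\<lambda>x. ball x (d x)"] conjI allI impI; (elim conjE)?)
      show "gauge (\<lambda>x. ball x (d x))" using d(1) by (simp add: gauge_ball_dependent)
      fix p assume p: "p tagged_division_of cbox a b" and fine: "(\<lambda>x. ball x (d x)) fine p"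
      have p': "p tagged_division_of {a..b}" using p by simp
      have fin: "finite p" using p by auto
      have Kuv: "\<exists>u v. K = {u..v} \<and> u \<le> x \<and> x \<le> v \<and> u \<in> {a..b} \<and> v \<in> {a..b} \<and> u \<in> ball x (d x) \<and> v \<in> ball x (d x)
         \<and> {u..v} \<subseteq> ball x (d x) \<and> x \<in> {a..b} \<and> Sup K = v \<and> Inf K = u \<and> measure lborel K = v - u"
        if xK: "(x, K) \<in> p" for x K
      proof -
        obtain u v where K: "K = {u..v}" using tagged_division_ofD(4)[OF p' xK] by auto
        have x: "x \<in> K" "K \<subseteq> {a..b}" using tagged_division_ofD(2,3)[OF p' xK] by simp_all
        have "K \<subseteq> ball x (d x)" using fine xK by (force simp: fine_def)
        moreover have "u \<le> x" "x \<le> v" using x(1) by (auto simp: K)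
        moreover have "u \<in> K" "v \<in> K" using x(1) by (auto simp: K)
        moreover have "Sup K = v" "Inf K = u" "measure lborel K = v - u" using x(1) by (auto simp: K)
        ultimately show ?thesis using K x by blast
      qed
      have SI: "Sup K - Inf K \<ge> 0" "measure lebesgue K = Sup K - Inf K" if xK: "(x, K) \<in> p" for x K
      proof -
        obtain u v where "K = {u..v}" "u \<le> v" "Sup K = v" "Inf K = u" using Kuv[OF xK] by force
        then show "Sup K - Inf K \<ge> 0" "measure lebesgue K = Sup K - Inf K"
          by (simp_all add: measure_completion)
      qed
      define q where "q = {z \<in> p. fst z \<in> N}"
      have qp: "q \<subseteq> p" by (auto simp: q_def)
      have "(\<Sum>(x,k)\<in>p. measure lborel k *\<^sub>R g x) - (f b - f a) =
          (\<Sum>(x,k)\<in>p. measure lborel k *\<^sub>R g x - (f (Sup k) - f (Inf k)))"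
        using additive_tagged_division_1[OF ab p', of f] by (simp add: sum_subtractf case_prod_beta)
      also have "\<dots> = (\<Sum>(x,k)\<in>p - q. measure lborel k *\<^sub>R g x - (f (Sup k) - f (Inf k)))
          + (\<Sum>(x,k)\<in>q. measure lborel k *\<^sub>R g x - (f (Sup k) - f (Inf k)))"
        by (rule sum.subset_diff[OF qp fin])
      also have "norm \<dots> \<le> e1 * (b - a) + (\<Sum>K\<in>snd ` q. norm (f (Sup K) - f (Inf K)))"
      proof (rule norm_triangle_mono)
        have "norm (\<Sum>(x,k)\<in>p - q. measure lborel k *\<^sub>R g x - (f (Sup k) - f (Inf k)))
            \<le> (\<Sum>(x,k)\<in>p - q. e1 * (Sup k - Inf k))"
        proof (rule sum_norm_le, clarify)
          fix x K assume xK: "(x, K) \<in> p" "(x, K) \<notin> q"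
          then have "x \<notin> N" by (auto simp: q_def)
          with Kuv[OF xK(1)] d(3)[of x] show "norm (measure lborel K *\<^sub>R g x - (f (Sup K) - f (Inf K))) \<le> e1 * (Sup K - Inf K)"
            by (auto simp: g_def)
        qed
        also have "\<dots> \<le> (\<Sum>(x,k)\<in>p. e1 * (Sup k - Inf k))"
          using SI(1) e1 by (intro sum_mono2 fin) (auto simp: case_prod_beta intro!: mult_nonneg_nonneg)
        also have "\<dots> = e1 * (b - a)"
          using additive_tagged_division_1[OF ab p', of "\<lambda>x. x"] by (simp add: sum_distrib_left[symmetric] case_prod_beta)
        finally show "norm (\<Sum>(x,k)\<in>p - q. measure lborel k *\<^sub>R g x - (f (Sup k) - f (Inf k))) \<le> e1 * (b - a)" .
        \<comment> \<open>Absolute continuity speaks of intervals without tags, so no interval may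
          occur under two tags.\<close>
        have inj: "inj_on snd q" using inj_on_snd_tagged_division_real[OF p'] qp inj_on_subset by blast
        have "(\<Sum>(x,k)\<in>q. measure lborel k *\<^sub>R g x - (f (Sup k) - f (Inf k))) = (\<Sum>(x,k)\<in>q. - (f (Sup k) - f (Inf k)))"
          by (intro sum.cong) (auto simp: q_def g_def)
        also have "norm \<dots> \<le> (\<Sum>(x,k)\<in>q. norm (f (Sup k) - f (Inf k)))"
          by (intro sum_norm_le) (auto simp: norm_minus_commute)
        also have "\<dots> = (\<Sum>K\<in>snd ` q. norm (f (Sup K) - f (Inf K)))"
          by (simp add: sum.reindex[OF inj] case_prod_beta)
        finally show "norm (\<Sum>(x,k)\<in>q. measure lborel k *\<^sub>R g x - (f (Sup k) - f (Inf k))) \<le>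
           (\<Sum>K\<in>snd ` q. norm (f (Sup K) - f (Inf K)))" .
      qed
      also have "\<dots> < e"
      proof -
        have qdiv: "snd ` q division_of \<Union> (snd ` q)"
          using p qp by (metis division_of_tagged_division tagged_division_of_def tagged_partial_division_subset tagged_partial_division_of_Union_self)
        have "(\<Sum>K\<in>snd ` q. Sup K - Inf K) = (\<Sum>K\<in>snd ` q. measure lebesgue K)"
          using SI(2) qp by (intro sum.cong) auto
        also have "\<dots> = measure lebesgue (\<Union> (snd ` q))" by (rule content_division[OF qdiv])
        also have "\<dots> \<le> measure lebesgue U"
        proof (rule measure_mono_fmeasurable[OF _ _ Ul])
          show "\<Union> (snd ` q) \<subseteq> U"
          proof clarsimp
            fix x K y assume "(x, K) \<in> q" "y \<in> K"
            then show "y \<in> U" using Kuv[of x K] d(2)[of x] qp by (auto simp: q_def)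
          qed
          show "\<Union> (snd ` q) \<in> sets lebesgue" using lmeasurable_division[OF qdiv] by auto
        qed
        finally have "(\<Sum>K\<in>snd ` q. Sup K - Inf K) < \<delta>" using mU by simp
        moreover have "\<Union> (snd ` q) \<subseteq> {a..b}" using p' qp by (auto dest!: tagged_division_ofD(3))
        ultimately have "(\<Sum>K\<in>snd ` q. norm (f (Sup K) - f (Inf K))) < e / 2"
          using \<delta>(2)[OF qdiv] by blast
        moreover have "e1 * (b - a) \<le> e / 2"
          using ab \<open>e > 0\<close> by (simp add: e1_def field_simps)
        ultimately show ?thesis by simp
      qed
      finally show "norm ((\<Sum>(x,k)\<in>p. measure lborel k *\<^sub>R g x) - (f b - f a)) < e" .
    qed
  qed
  then have "(g has_integral (f b - f a)) {a..b}" by simp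
  then show ?thesis by (rule has_integral_spike[OF N, rotated]) (auto simp: g_def)
qed

section \<open>One-sided Lipschitz fields and their convexifications\<close>

lemma inner_le_on_closure_convex_hull:
  fixes S :: "'a::euclidean_space set"
  assumes "\<And>c. c \<in> S \<Longrightarrow> u \<bullet> c \<le> m" "v \<in> closure (convex hull S)"
  shows "u \<bullet> v \<le> m"
proof -
  have "S \<subseteq> {c. u \<bullet> c \<le> m}" using assms(1) by auto
  then have "convex hull S \<subseteq> {c. u \<bullet> c \<le> m}" by (rule hull_minimal) (rule convex_halfspace_le)
  then have "closure (convex hull S) \<subseteq> {c. u \<bullet> c \<le> m}" by (rule closure_minimal) (rule closed_halfspace_le)
  then show ?thesis using assms(2) by auto
qed

lemma Convess_subset_closed_convex:
  assumes "v \<in> Convess b z" "r > 0"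
  shows "v \<in> closure (convex hull (b ` ball z r))"
  using assms unfolding Convess_def by (force dest!: bspec[of _ _ r] bspec[of _ _ "{}"])

lemma norm_Convess_le:
  assumes "v \<in> Convess b z" "\<And>x. norm (b x) \<le> L"
  shows "norm v \<le> L"
proof -
  have "convex hull (b ` ball z 1) \<subseteq> cball 0 L" using assms(2) by (intro hull_minimal) auto
  then have "closure (convex hull (b ` ball z 1)) \<subseteq> cball 0 L" by (intro closure_minimal) auto
  then show ?thesis using Convess_subset_closed_convex[OF assms(1), of 1] by auto
qed

lemma le_of_le_continuous_at_0:
  fixes f :: "real \<Rightarrow> real"
  assumes "\<And>r. r > 0 \<Longrightarrow> c \<le> f r" "isCont f 0"
  shows "c \<le> f 0"
proof (rule tendsto_lowerbound)
  show "(f \<longlongrightarrow> f 0) (at_right 0)" using assms(2) by (simp add: isCont_def filterlim_at_split)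
  show "eventually (\<lambda>r. c \<le> f r) (at_right 0)" using assms(1) by (simp add: eventually_at_filter)
qed simp

text \<open>For fixed \<open>y\<close> the inequality is affine in the velocity. It holds at the
  values \<open>b x\<close> with \<open>x\<close> near \<open>z\<close>, up to an error that
  vanishes with the radius \<open>r\<close>, and therefore on the closed convex hull of these
  values. The vector \<open>w\<close> is left arbitrary so that the lemma can be applied at both
  points in turn.\<close>

lemma one_sided_Lipschitz_Convess:
  fixes b :: "real ^ 'd \<Rightarrow> real ^ 'd"
  assumes osl: "\<And>x. (w - b x) \<bullet> (y - x) \<le> A * (norm (y - x))\<^sup>2"
    and bd: "\<And>x. norm (b x) \<le> L" and A: "A \<ge> 0" and v: "v \<in> Convess b z"
  shows "(w - v) \<bullet> (y - z) \<le> A * (norm (y - z))\<^sup>2"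
proof -
  have "(w - v) \<bullet> (y - z) \<le> A * (norm (y - z) + r)\<^sup>2 + (norm w + L) * r" if r: "r > 0" for r
  proof -
    \<comment> \<open>The claim as a half-space with normal \<open>z - y\<close>: the term with
      \<open>w\<close> is moved to the right.\<close>
    have "(z - y) \<bullet> v \<le> A * (norm (y - z) + r)\<^sup>2 + (norm w + L) * r - w \<bullet> (y - z)"
    proof (rule inner_le_on_closure_convex_hull[OF _ Convess_subset_closed_convex[OF v r]])
      fix c assume "c \<in> b ` ball z r"
      then obtain x where x: "c = b x" "norm (z - x) < r" by (auto simp: dist_norm)
      have "(w - b x) \<bullet> (y - z) = (w - b x) \<bullet> (y - x) + (w - b x) \<bullet> (x - z)" by (simp add: inner_simps)
      also have "(w - b x) \<bullet> (y - x) \<le> A * (norm (y - x))\<^sup>2" by (rule osl)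
      also have "A * (norm (y - x))\<^sup>2 \<le> A * (norm (y - z) + r)\<^sup>2"
      proof (intro mult_left_mono power_mono A)
        have "norm (y - x) \<le> norm (y - z) + norm (z - x)" by (metis norm_triangle_ineq diff_add_cancel add_diff_eq)
        then show "norm (y - x) \<le> norm (y - z) + r" using x(2) by simp
      qed simp
      also have "(w - b x) \<bullet> (x - z) \<le> norm (w - b x) * norm (x - z)" by (rule norm_cauchy_schwarz)
      also have "\<dots> \<le> (norm w + L) * r"
        using x(2) bd[of x] norm_triangle_ineq4[of w "b x"] by (intro mult_mono) (auto simp: norm_minus_commute intro: add_nonneg_nonneg order_trans[OF norm_ge_zero bd])
      finally show "(z - y) \<bullet> c \<le> A * (norm (y - z) + r)\<^sup>2 + (norm w + L) * r - w \<bullet> (y - z)"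
        by (simp add: x(1) inner_simps inner_commute)
    qed
    then show ?thesis by (simp add: inner_simps inner_commute)
  qed
  from le_of_le_continuous_at_0[of "(w - v) \<bullet> (y - z)" "\<lambda>r. A * (norm (y - z) + r)\<^sup>2 + (norm w + L) * r", OF this]
  show ?thesis by simp
qed

text \<open>The previous lemma twice: with \<open>b x\<close> as the fixed velocity it yields the
  inequality between \<open>v\<close> and all values of \<open>b\<close>, which is the hypothesis of
  the second use, where \<open>v\<close> is the fixed velocity.\<close>

lemma one_sided_Lipschitz_Convess_Convess:
  fixes b :: "real ^ 'd \<Rightarrow> real ^ 'd"
  assumes osl: "\<And>x y. (b x - b y) \<bullet> (x - y) \<le> A * (norm (x - y))\<^sup>2"
    and bd: "\<And>x. norm (b x) \<le> L" and A: "A \<ge> 0"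
    and v: "v \<in> Convess b z" and w: "w \<in> Convess b y"
  shows "(w - v) \<bullet> (y - z) \<le> A * (norm (y - z))\<^sup>2"
proof -
  have "(v - b x) \<bullet> (z - x) \<le> A * (norm (z - x))\<^sup>2" for x
    using one_sided_Lipschitz_Convess[of "b x" b x A L v z, OF osl bd A v]
    by (simp add: inner_diff_left inner_diff_right norm_minus_commute)
  from one_sided_Lipschitz_Convess[of v b z A L w y, OF this bd A w]
  show ?thesis by (simp add: inner_diff_left inner_diff_right norm_minus_commute)
qed

text \<open>Points where the bound holds are dense. If it fails at \<open>x\<close>, a step of
  length about \<epsilon> from \<open>x\<close> against the direction of \<open>b x\<close> leads to
  such a point \<open>y\<close>. The left side of the Lipschitz condition is then at least a
  constant times \<epsilon>, the right side only of order \<epsilon>^2.\<close>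

lemma bounded_everywhere_of_one_sided_Lipschitz:
  fixes b :: "real ^ 'd \<Rightarrow> real ^ 'd"
  assumes osl: "\<And>x y. (b x - b y) \<bullet> (x - y) \<le> A * (norm (x - y))\<^sup>2" and A: "A \<ge> 0"
    and ae: "AE x in lebesgue. norm (b x) \<le> L"
  shows "norm (b x) \<le> L"
proof (rule ccontr)
  assume "\<not> norm (b x) \<le> L"
  then have gt: "norm (b x) > L" by simp
  have good: "\<exists>y\<in>ball c r. norm (b y) \<le> L" if "r > 0" for c r
  proof (rule ccontr)
    assume "\<not> ?thesis"
    then have "ball c r \<subseteq> {x. \<not> norm (b x) \<le> L}" by auto
    moreover have "negligible {x. \<not> norm (b x) \<le> L}"
      using ae by (simp add: completion.AE_iff_null_sets negligible_iff_null_sets)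
    ultimately have "negligible (ball c r)" by (rule negligible_subset[rotated])
    then show False using that open_not_negligible[of "ball c r"] by auto
  qed
  have L: "L \<ge> 0" using good[of 1 0] by (force intro: order_trans[OF norm_ge_zero])
  define u where "u = b x /\<^sub>R norm (b x)"
  have bx: "norm (b x) > 0" using gt L by linarith
  have u: "norm u = 1" using bx by (simp add: u_def)
  have bu: "b x \<bullet> u = norm (b x)" using bx by (simp add: u_def dot_square_norm power2_eq_square)
  define c where "c = norm (b x) - L"
  have c: "c > 0" using gt by (simp add: c_def)
  \<comment> \<open>A good point is only found within \<epsilon> * \<eta> of the target
    \<open>x - \<epsilon> *\<^sub>R u\<close>; \<eta> is chosen so that this inaccuracy costs at
    most half of the gain \<epsilon> * \<open>c\<close>.\<close>
  define \<eta> where "\<eta> = min 1 (c / (2 * (norm (b x) + L)))"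
  have \<eta>: "\<eta> > 0" "\<eta> \<le> 1" "(norm (b x) + L) * \<eta> \<le> c / 2"
  proof -
    show "\<eta> > 0" "\<eta> \<le> 1" using c bx L by (auto simp: \<eta>_def intro!: divide_pos_pos add_pos_nonneg)
    have "(norm (b x) + L) * \<eta> \<le> (norm (b x) + L) * (c / (2 * (norm (b x) + L)))"
      using bx L by (intro mult_left_mono) (auto simp: \<eta>_def)
    also have "(norm (b x) + L) * (c / (2 * (norm (b x) + L))) = c / 2"
    proof -
      have "norm (b x) + L \<noteq> 0" using bx L by linarith
      moreover have "S * (c / (2 * S)) = c / 2" if "S \<noteq> 0" for S :: real using that by simp
      ultimately show ?thesis by blast
    qed
    finally show "(norm (b x) + L) * \<eta> \<le> c / 2" .
  qed
  have "c / 2 \<le> 4 * A * \<epsilon>" if e: "\<epsilon> > 0" for \<epsilon>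
  proof -
    obtain y where y: "dist (x - \<epsilon> *\<^sub>R u) y < \<epsilon> * \<eta>" "norm (b y) \<le> L"
      using good[of "\<epsilon> * \<eta>" "x - \<epsilon> *\<^sub>R u"] e \<eta> by auto
    define w where "w = x - y - \<epsilon> *\<^sub>R u"
    have xy: "x - y = \<epsilon> *\<^sub>R u + w" by (simp add: w_def)
    have w: "norm w < \<epsilon> * \<eta>" using y(1) by (simp add: w_def dist_norm algebra_simps)
    have "(b x - b y) \<bullet> (x - y) = \<epsilon> * (norm (b x) - b y \<bullet> u) + (b x - b y) \<bullet> w"
      by (simp add: xy inner_simps bu algebra_simps)
    moreover have "b y \<bullet> u \<le> L" using norm_cauchy_schwarz[of "b y" u] u y(2) by simp
    then have "\<epsilon> * (norm (b x) - b y \<bullet> u) \<ge> \<epsilon> * c" using e by (simp add: c_def)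
    moreover have "(b x - b y) \<bullet> w \<ge> - (\<epsilon> * (c / 2))"
    proof -
      have "\<bar>(b x - b y) \<bullet> w\<bar> \<le> norm (b x - b y) * norm w" by (rule Cauchy_Schwarz_ineq2)
      also have "\<dots> \<le> (norm (b x) + L) * (\<epsilon> * \<eta>)"
        using w y(2) norm_triangle_ineq4[of "b x" "b y"] L by (intro mult_mono) auto
      also have "\<dots> \<le> \<epsilon> * (c / 2)" using mult_left_mono[OF \<eta>(3), of \<epsilon>] e by (simp add: mult.left_commute)
      finally show ?thesis by linarith
    qed
    ultimately have "\<epsilon> * (c / 2) \<le> (b x - b y) \<bullet> (x - y)" by (simp add: algebra_simps)
    also have "\<dots> \<le> A * (norm (x - y))\<^sup>2" by (rule osl)
    also have "\<dots> \<le> A * (2 * \<epsilon>)\<^sup>2"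
    proof (intro mult_left_mono power_mono A)
      have "norm (x - y) \<le> \<epsilon> + norm w" using norm_triangle_ineq[of "\<epsilon> *\<^sub>R u" w] u e by (simp add: xy)
      also have "\<epsilon> * \<eta> \<le> \<epsilon>" using \<eta> e by simp
      then have "\<epsilon> + norm w \<le> 2 * \<epsilon>" using w by linarith
      finally show "norm (x - y) \<le> 2 * \<epsilon>" .
    qed simp
    finally have "\<epsilon> * (c / 2) \<le> \<epsilon> * (4 * A * \<epsilon>)" by (simp add: power2_eq_square algebra_simps)
    then show ?thesis using e by (simp only: mult_le_cancel_left_pos)
  qed
  then have "c / 2 \<le> 4 * A * 0" by (rule le_of_le_continuous_at_0[where f = "\<lambda>\<epsilon>. 4 * A * \<epsilon>"]) auto
  then show False using c by simp
qed

section \<open>The Filippov flow\<close>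

text \<open>\<open>D\<close> is the separation at time \<open>s\<close>, \<open>I\<close> its
  change, \<open>u\<close> the relative velocity, and \<zeta> the separation at which the Lipschitz
  inequality holds. Replacing \<open>D\<close> by \<zeta> in the product with \<open>u\<close> costs
  \<open>M * \<kappa>\<close>, and |\<zeta>|^2 is at most 2 (|D|^2 + \<kappa>^2); with the 2 of the
  expanded square this gives the factor 4. It is not assumed that \<zeta> moves with velocity
  \<open>u\<close>: for the scheme the grid point stays frozen during the step.\<close>

lemma norm_sq_step:
  fixes u \<zeta> :: "real \<Rightarrow> 'a::euclidean_space"
  assumes st: "s \<le> t" and u: "(u has_integral I) {s..t}" and \<alpha>: "\<alpha> integrable_on {s..t}"
    and \<alpha>0: "\<And>\<sigma>. \<sigma> \<in> {s..t} \<Longrightarrow> \<alpha> \<sigma> \<ge> 0" and N: "negligible N"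
    and M0: "M \<ge> 0" and \<kappa>0: "\<kappa> \<ge> 0"
    and M: "\<And>\<sigma>. \<sigma> \<in> {s..t} - N \<Longrightarrow> norm (u \<sigma>) \<le> M"
    and osl: "\<And>\<sigma>. \<sigma> \<in> {s..t} - N \<Longrightarrow> u \<sigma> \<bullet> \<zeta> \<sigma> \<le> \<alpha> \<sigma> * (norm (\<zeta> \<sigma>))\<^sup>2"
    and \<kappa>: "\<And>\<sigma>. \<sigma> \<in> {s..t} - N \<Longrightarrow> norm (\<zeta> \<sigma> - D) \<le> \<kappa>"
  shows "(norm (D + I))\<^sup>2 + \<kappa>\<^sup>2 \<le> (1 + 4 * integral {s..t} \<alpha>) * ((norm D)\<^sup>2 + \<kappa>\<^sup>2)
           + 2 * M * \<kappa> * (t - s) + M\<^sup>2 * (t - s)\<^sup>2"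
proof -
  define v where "v \<sigma> = (if \<sigma> \<in> N then 0 else u \<sigma>)" for \<sigma>
  have v: "(v has_integral I) {s..t}"
    by (rule has_integral_spike[OF N _ u]) (auto simp: v_def)
  define E where "E = 2 * ((norm D)\<^sup>2 + \<kappa>\<^sup>2)"
  have "norm I \<le> M * (t - s)"
  proof -
    have "norm I \<le> M * measure lborel (cbox s t)"
      by (rule has_integral_bound[OF M0]) (use v M M0 in \<open>auto simp: v_def\<close>)
    then show ?thesis using st by simp
  qed
  then have I: "(norm I)\<^sup>2 \<le> M\<^sup>2 * (t - s)\<^sup>2"
    using power_mono[of "norm I" "M * (t - s)" 2] by (simp add: power_mult_distrib)
  have "D \<bullet> I \<le> integral {s..t} \<alpha> * E + M * \<kappa> * (t - s)"
  proof (rule has_integral_le)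
    show "((\<lambda>\<sigma>. D \<bullet> v \<sigma>) has_integral D \<bullet> I) {s..t}"
      using has_integral_linear[OF v bounded_linear_inner_right[of D]] by (simp add: o_def)
    have "((\<lambda>\<sigma>. M * \<kappa>) has_integral M * \<kappa> * (t - s)) {s..t}"
      using has_integral_const_real[of "M * \<kappa>" s t] st by (simp add: mult.commute)
    then show "((\<lambda>\<sigma>. \<alpha> \<sigma> * E + M * \<kappa>) has_integral integral {s..t} \<alpha> * E + M * \<kappa> * (t - s)) {s..t}"
      by (intro has_integral_add has_integral_mult_left integrable_integral \<alpha>)
    fix \<sigma> assume \<sigma>: "\<sigma> \<in> {s..t}"
    show "D \<bullet> v \<sigma> \<le> \<alpha> \<sigma> * E + M * \<kappa>"
    proof (cases "\<sigma> \<in> N")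
      case True
      then show ?thesis using \<alpha>0[OF \<sigma>] M0 \<kappa>0 by (simp add: v_def E_def)
    next
      case False
      then have \<sigma>': "\<sigma> \<in> {s..t} - N" using \<sigma> by auto
      have "D \<bullet> v \<sigma> = u \<sigma> \<bullet> \<zeta> \<sigma> + u \<sigma> \<bullet> (D - \<zeta> \<sigma>)"
        using False by (simp add: v_def inner_simps inner_commute)
      also have "u \<sigma> \<bullet> \<zeta> \<sigma> \<le> \<alpha> \<sigma> * (norm (\<zeta> \<sigma>))\<^sup>2" by (rule osl[OF \<sigma>'])
      also have "\<dots> \<le> \<alpha> \<sigma> * E"
      proof (rule mult_left_mono[OF _ \<alpha>0[OF \<sigma>]])
        have "norm (\<zeta> \<sigma>) \<le> norm D + \<kappa>" using \<kappa>[OF \<sigma>'] norm_triangle_ineq2[of "\<zeta> \<sigma>" D] by simp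
        then have "(norm (\<zeta> \<sigma>))\<^sup>2 \<le> (norm D + \<kappa>)\<^sup>2" by (intro power_mono) auto
        also have "\<dots> \<le> E" using sum_squares_bound[of "norm D" \<kappa>] by (simp add: E_def power2_sum)
        finally show "(norm (\<zeta> \<sigma>))\<^sup>2 \<le> E" .
      qed
      also have "u \<sigma> \<bullet> (D - \<zeta> \<sigma>) \<le> norm (u \<sigma>) * norm (D - \<zeta> \<sigma>)" by (rule norm_cauchy_schwarz)
      also have "\<dots> \<le> M * \<kappa>" using M[OF \<sigma>'] \<kappa>[OF \<sigma>'] M0 by (intro mult_mono) (auto simp: norm_minus_commute)
      finally show ?thesis by simp
    qed
  qed
  moreover have "(norm (D + I))\<^sup>2 = (norm D)\<^sup>2 + 2 * (D \<bullet> I) + (norm I)\<^sup>2"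
    by (simp add: power2_norm_eq_inner inner_simps inner_commute)
  ultimately show ?thesis using I by (simp add: E_def algebra_simps)
qed

lemma discrete_Gronwall:
  fixes e :: "nat \<Rightarrow> real"
  assumes "\<And>j. e (Suc j) \<le> (1 + \<delta> j) * e j + c" "\<And>j. \<delta> j \<ge> 0" "c \<ge> 0" "e 0 \<ge> 0"
  shows "e n \<le> exp (\<Sum>j<n. \<delta> j) * (e 0 + n * c)"
proof (induction n)
  case (Suc n)
  have "e (Suc n) \<le> (1 + \<delta> n) * e n + c" by (rule assms)
  also have "\<dots> \<le> (1 + \<delta> n) * (exp (\<Sum>j<n. \<delta> j) * (e 0 + n * c)) + c"
    using Suc assms(2)[of n] by (intro add_mono mult_left_mono) auto
  \<comment> \<open>The additive error is enlarged by the whole exponential too, so that both terms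
    share one factor.\<close>
  also have "\<dots> \<le> exp (\<delta> n) * (exp (\<Sum>j<n. \<delta> j) * (e 0 + n * c)) + exp (\<Sum>j<Suc n. \<delta> j) * c"
  proof (intro add_mono mult_right_mono)
    have "exp (\<Sum>j<Suc n. \<delta> j) \<ge> 1" using assms(2) by (simp del: sum.lessThan_Suc add: sum_nonneg)
    then show "c \<le> exp (\<Sum>j<Suc n. \<delta> j) * c" using assms(3) by (simp add: mult_le_cancel_right1)
  qed (use assms in auto)
  also have "\<dots> = exp (\<Sum>j<Suc n. \<delta> j) * (e 0 + Suc n * c)"
    by (simp add: exp_add algebra_simps)
  finally show ?case .
qed simp

section \<open>From the essential bound in time and space to bounds at every point\<close>

lemma sigma_finite_completion:
  assumes "sigma_finite_measure M"
  shows "sigma_finite_measure (completion M)"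
proof -
  interpret sigma_finite_measure M by fact
  obtain A where "countable A" "A \<subseteq> sets M" "\<Union>A = space M" "\<forall>a\<in>A. emeasure M a \<noteq> \<infinity>"
    using sigma_finite_countable by auto
  then show ?thesis
    by unfold_locales (auto intro!: exI[of _ A] simp: subset_iff emeasure_completion)
qed

text \<open>Fubini gives, for almost every \<open>t\<close>, an essential bound in \<open>x\<close>,
  which the Lipschitz condition at that time makes pointwise. The exceptional times do not depend on
  \<open>x\<close>, so the bound may be evaluated along grid points and trajectories.\<close>

lemma AE_bounded_everywhere:
  fixes a :: "real \<Rightarrow> real ^ 'd \<Rightarrow> real ^ 'd"
  assumes jm: "jointly_measurable a" and L: "Linf_norm a = ereal L"
    and \<alpha>: "\<And>t. t \<ge> 0 \<Longrightarrow> \<alpha> t \<ge> 0" and osl: "one_sided_Lipschitz a \<alpha>"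
  shows "AE t in lebesgue. t \<ge> 0 \<longrightarrow> (\<forall>x. norm (a t x) \<le> L)"
proof -
  interpret T: sigma_finite_measure "lebesgue_on {0::real..}"
    by (rule sigma_finite_measure_restrict_space[OF sigma_finite_completion[OF sigma_finite_lborel]]) auto
  interpret X: sigma_finite_measure "lebesgue :: (real ^ 'd) measure"
    by (rule sigma_finite_completion[OF sigma_finite_lborel])
  interpret P: pair_sigma_finite "lebesgue_on {0::real..}" "lebesgue :: (real ^ 'd) measure" ..
  have "AE z in time_space. (case z of (t, x) \<Rightarrow> ereal (norm (a t x))) \<le> ereal L"
    unfolding L[symmetric] Linf_norm_def by (rule esssup_AE)
  then have "AE z in time_space. norm (a (fst z) (snd z)) \<le> L" by (simp add: case_prod_beta)
  from P.AE_pair[OF this] have "AE t in lebesgue_on {0..}. AE x in lebesgue. norm (a t x) \<le> L" by simp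
  then have "AE t in lebesgue. t \<ge> 0 \<longrightarrow> (AE x in lebesgue. norm (a t x) \<le> L)"
    by (subst (asm) AE_restrict_space_iff) auto
  then show ?thesis
  proof eventually_elim
    case (elim t)
    show ?case
    proof (intro impI allI)
      fix x assume "t \<ge> 0"
      then show "norm (a t x) \<le> L"
        using elim \<alpha> osl unfolding one_sided_Lipschitz_def
        by (intro bounded_everywhere_of_one_sided_Lipschitz[of "a t" "\<alpha> t"]) auto
    qed
  qed
qed

text \<open>Norms being non-negative, a negative \<open>L\<close> would make every time in (0,1)
  exceptional.\<close>

lemma Linf_norm_nonneg:
  assumes "Linf_norm (a :: real \<Rightarrow> real ^ 'd \<Rightarrow> real ^ 'd) = ereal L" and \<alpha>: "\<And>t. t \<ge> 0 \<Longrightarrow> \<alpha> t \<ge> 0" 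
    and osl: "one_sided_Lipschitz a \<alpha>" "jointly_measurable a"
  shows "L \<ge> 0"
proof -
  have "AE t in lebesgue. t \<ge> 0 \<longrightarrow> (\<forall>x. norm (a t x) \<le> L)"
    using AE_bounded_everywhere[of a L \<alpha>] assms by auto
  then have n: "negligible {t. \<not> (t \<ge> 0 \<longrightarrow> (\<forall>x. norm (a t x) \<le> L))}"
    by (simp add: completion.AE_iff_null_sets negligible_iff_null_sets)
  show ?thesis
  proof (rule ccontr)
    assume "\<not> L \<ge> 0"
    then have "{0<..<1} \<subseteq> {t. \<not> (t \<ge> 0 \<longrightarrow> (\<forall>x. norm (a t x) \<le> L))}"
      by (auto intro!: exI[of _ 0]) (smt (verit) norm_ge_zero)
    then have "negligible {0<..<1::real}" using n negligible_subset by blast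
    then show False using open_not_negligible[of "{0<..<1::real}"] by auto
  qed
qed

text \<open>Joint measurability refers to the product sigma-algebra and not to its completion, so
  the section at every single point \<open>X\<close> is measurable, in particular at a grid
  point.\<close>

lemma set_integrable_velocity:
  fixes a :: "real \<Rightarrow> real ^ 'd \<Rightarrow> real ^ 'd"
  assumes jm: "jointly_measurable a" 
    and bd: "AE t in lebesgue. t \<ge> 0 \<longrightarrow> (\<forall>x. norm (a t x) \<le> L)"
    and s: "0 \<le> s"
  shows "set_integrable lebesgue {s..t} (\<lambda>\<sigma>. a \<sigma> X)"
proof -
  have "(\<lambda>\<sigma>. (\<lambda>(t, x). a t x) (\<sigma>, X)) \<in> lebesgue_on {0..} \<rightarrow>\<^sub>M borel"
    by (rule measurable_compose[OF measurable_Pair2' jm[unfolded jointly_measurable_def]]) simp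
  then have "(\<lambda>\<sigma>. a \<sigma> X) \<in> borel_measurable (lebesgue_on {0..})" by simp
  then have "(\<lambda>\<sigma>. a \<sigma> X) \<in> borel_measurable (lebesgue_on {s..t})"
    by (rule measurable_restrict_mono) (use s in auto)
  then have m: "(\<lambda>\<sigma>. indicat_real {s..t} \<sigma> *\<^sub>R a \<sigma> X) \<in> borel_measurable lebesgue"
    by (subst (asm) borel_measurable_restrict_space_iff) auto
  show ?thesis unfolding set_integrable_def
  proof (rule integrableI_bounded_set[OF _ m, where A = "{s..t}" and B = L])
    show "AE x in lebesgue. x \<in> {s..t} \<longrightarrow> norm (indicat_real {s..t} x *\<^sub>R a x X) \<le> L"
      using bd by eventually_elim (use s in auto)
  qed (auto simp: emeasure_lborel_Icc_eq)
qed

section \<open>Regularity of the flow in time and space\<close>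

locale Filippov_transport =
  fixes a :: "real \<Rightarrow> real ^ 'd \<Rightarrow> real ^ 'd" and \<alpha> :: "real \<Rightarrow> real"
    and Z :: "real \<Rightarrow> real ^ 'd \<Rightarrow> real ^ 'd" and L :: real
  assumes jm: "jointly_measurable a" and Linf: "Linf_norm a = ereal L"
    and \<alpha>_nonneg: "\<And>t. t \<ge> 0 \<Longrightarrow> \<alpha> t \<ge> 0" and \<alpha>_L1: "L1_loc \<alpha>"
    and osl: "one_sided_Lipschitz a \<alpha>" and flow: "Filippov_flow a Z"
begin

lemma L_nonneg: "L \<ge> 0"
  using Linf_norm_nonneg[OF Linf \<alpha>_nonneg osl jm] .

lemma oslD: "t \<ge> 0 \<Longrightarrow> (a t x - a t y) \<bullet> (x - y) \<le> \<alpha> t * (norm (x - y))\<^sup>2"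
  using osl by (auto simp: one_sided_Lipschitz_def)

lemma Z_0 [simp]: "Z 0 x = x"
  using flow by (simp add: Filippov_flow_def)

lemma AE_bounded: "AE t in lebesgue. t \<ge> 0 \<longrightarrow> (\<forall>x. norm (a t x) \<le> L)"
  by (rule AE_bounded_everywhere[OF jm Linf \<alpha>_nonneg osl])

lemma \<alpha>_set_integrable: "0 \<le> t \<Longrightarrow> set_integrable lebesgue {0..t} \<alpha>"
  using \<alpha>_L1 by (simp add: L1_loc_def)

lemma \<alpha>_integrable: "0 \<le> s \<Longrightarrow> \<alpha> integrable_on {s..t}"
proof (cases "s \<le> t")
  case True
  assume "0 \<le> s"
  then have "\<alpha> integrable_on {0..t}" using True by (intro set_lebesgue_integral_eq_integral \<alpha>_set_integrable) auto
  then show ?thesis by (rule integrable_on_subinterval) (use \<open>0 \<le> s\<close> in auto)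
qed auto

lemma \<alpha>_integral_nonneg: "0 \<le> s \<Longrightarrow> integral {s..t} \<alpha> \<ge> 0"
  by (intro integral_nonneg \<alpha>_integrable) (auto intro: \<alpha>_nonneg)

lemma \<alpha>_integral_combine: "0 \<le> s \<Longrightarrow> s \<le> t \<Longrightarrow> integral {0..s} \<alpha> + integral {s..t} \<alpha> = integral {0..t} \<alpha>"
  by (intro Henstock_Kurzweil_Integration.integral_combine \<alpha>_integrable) auto

lemma velocity_has_integral:
  assumes "0 \<le> s"
  shows "((\<lambda>\<sigma>. a \<sigma> X) has_integral (LINT \<sigma>:{s..t}|lebesgue. a \<sigma> X)) {s..t}"
  by (rule has_integral_set_lebesgue[OF set_integrable_velocity[OF jm AE_bounded assms]])

text \<open>The velocity is selected pointwise by choice. No measurability of the selection has to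
  be shown: outside \<open>N\<close> it is the derivative of the curve, and the fundamental theorem
  above delivers its integrability. \<open>N\<close> also collects the times at which the bound
  \<open>L\<close> fails.\<close>

lemma flow_velocity:
  obtains v N where "negligible N"
    "\<And>t. t \<ge> 0 \<Longrightarrow> t \<notin> N \<Longrightarrow> (\<forall>x. norm (a t x) \<le> L) \<and> v t \<in> Convess (a t) (Z t x)"
    "\<And>s t. 0 \<le> s \<Longrightarrow> s \<le> t \<Longrightarrow> (v has_integral (Z t x - Z s x)) {s..t}"
proof -
  define P where "P t v \<longleftrightarrow> v \<in> Convess (a t) (Z t x) \<and> ((\<lambda>s. Z s x) has_vector_derivative v) (at t within {0..})" for t v
  define v where "v t = (SOME v. P t v)" for t
  define N where "N = {t. \<not> (t \<ge> 0 \<longrightarrow> (\<forall>x. norm (a t x) \<le> L) \<and> (\<exists>v. P t v))}"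
  have "AE t in lebesgue. t \<ge> 0 \<longrightarrow> (\<exists>v. P t v)"
    using flow unfolding Filippov_flow_def P_def Bex_def by blast
  then have "AE t in lebesgue. t \<ge> 0 \<longrightarrow> (\<forall>x. norm (a t x) \<le> L) \<and> (\<exists>v. P t v)"
    using AE_bounded by eventually_elim auto
  then have N: "negligible N" by (simp add: completion.AE_iff_null_sets negligible_iff_null_sets N_def)
  have v: "P t (v t)" if "t \<ge> 0" "t \<notin> N" for t
    using that someI_ex[of "P t"] by (auto simp: N_def v_def)
  show thesis
  proof (rule that[of N v, OF N])
    show "(\<forall>x. norm (a t x) \<le> L) \<and> v t \<in> Convess (a t) (Z t x)" if "t \<ge> 0" "t \<notin> N" for t
      using that v[of t] by (auto simp: N_def P_def)
    fix s t :: real assume st: "0 \<le> s" "s \<le> t"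
    show "(v has_integral (Z t x - Z s x)) {s..t}"
    proof (rule has_integral_of_absolutely_continuous[OF st(2) _ N])
      have "{s..t} \<subseteq> {0..t}" using st by auto
      moreover have "absolutely_continuous_on 0 t (\<lambda>t. Z t x)"
        using flow st by (auto simp: Filippov_flow_def)
      ultimately show "absolutely_continuous_on s t (\<lambda>t. Z t x)"
        unfolding absolutely_continuous_on_def by (meson order_trans)
      fix \<sigma> assume "\<sigma> \<in> {s..t} - N"
      then have "P \<sigma> (v \<sigma>)" using st by (intro v) auto
      then show "((\<lambda>t. Z t x) has_vector_derivative v \<sigma>) (at \<sigma> within {s..t})"
        unfolding P_def by (rule has_vector_derivative_within_subset[OF conjunct2]) (use st in auto)
    qed
  qed
qed

lemma flow_Lipschitz_time:
  assumes "0 \<le> s" "s \<le> t"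
  shows "norm (Z t x - Z s x) \<le> L * (t - s)"
proof -
  obtain v N where vN: "negligible N"
    "\<And>t. t \<ge> 0 \<Longrightarrow> t \<notin> N \<Longrightarrow> (\<forall>x. norm (a t x) \<le> L) \<and> v t \<in> Convess (a t) (Z t x)"
    "\<And>s t. 0 \<le> s \<Longrightarrow> s \<le> t \<Longrightarrow> (v has_integral (Z t x - Z s x)) {s..t}"
    by (rule flow_velocity[of x]) blast
  have "((\<lambda>\<sigma>. if \<sigma> \<in> N then 0 else v \<sigma>) has_integral (Z t x - Z s x)) (cbox s t)"
    by (rule has_integral_spike[OF vN(1), of _ _ v]) (use vN(3)[OF assms] in auto)
  then have "norm (Z t x - Z s x) \<le> L * measure lborel (cbox s t)"
  proof (rule has_integral_bound[OF L_nonneg])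
    fix \<sigma> assume "\<sigma> \<in> cbox s t"
    then show "norm (if \<sigma> \<in> N then 0 else v \<sigma>) \<le> L"
      using vN(2)[of \<sigma>] norm_Convess_le[of "v \<sigma>" "a \<sigma>" "Z \<sigma> x" L] assms L_nonneg by auto
  qed
  then show ?thesis using assms by simp
qed

text \<open>\<open>h\<close> bounds the change of the separation, since both trajectories have speed
  at most \<open>L\<close>. The constant 12 is 8 + 4: the term \<open>2 * (2 * L) * h\<close>, and
  the square of the relative speed \<open>2 * L\<close>.\<close>

lemma flow_contraction_step:
  assumes st: "0 \<le> s" "s \<le> t"
  defines "h \<equiv> 2 * L * (t - s)"
  shows "(norm (Z t x - Z t y))\<^sup>2 + h\<^sup>2 \<le> (1 + 4 * integral {s..t} \<alpha>) * ((norm (Z s x - Z s y))\<^sup>2 + h\<^sup>2)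
     + 12 * L\<^sup>2 * (t - s)\<^sup>2"
proof -
  obtain v N where v: "negligible N"
    "\<And>t. t \<ge> 0 \<Longrightarrow> t \<notin> N \<Longrightarrow> (\<forall>x. norm (a t x) \<le> L) \<and> v t \<in> Convess (a t) (Z t x)"
    "\<And>s t. 0 \<le> s \<Longrightarrow> s \<le> t \<Longrightarrow> (v has_integral (Z t x - Z s x)) {s..t}"
    by (rule flow_velocity[of x]) blast
  obtain w N' where w: "negligible N'"
    "\<And>t. t \<ge> 0 \<Longrightarrow> t \<notin> N' \<Longrightarrow> (\<forall>x. norm (a t x) \<le> L) \<and> w t \<in> Convess (a t) (Z t y)"
    "\<And>s t. 0 \<le> s \<Longrightarrow> s \<le> t \<Longrightarrow> (w has_integral (Z t y - Z s y)) {s..t}"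
    by (rule flow_velocity[of y]) blast
  have "(norm ((Z s x - Z s y) + ((Z t x - Z s x) - (Z t y - Z s y))))\<^sup>2 + h\<^sup>2 \<le>
      (1 + 4 * integral {s..t} \<alpha>) * ((norm (Z s x - Z s y))\<^sup>2 + h\<^sup>2)
      + 2 * (2 * L) * h * (t - s) + (2 * L)\<^sup>2 * (t - s)\<^sup>2"
  proof (rule norm_sq_step[where N = "N \<union> N'" and u = "\<lambda>\<sigma>. v \<sigma> - w \<sigma>" and \<zeta> = "\<lambda>\<sigma>. Z \<sigma> x - Z \<sigma> y"])
    show "((\<lambda>\<sigma>. v \<sigma> - w \<sigma>) has_integral Z t x - Z s x - (Z t y - Z s y)) {s..t}"
      by (intro has_integral_diff v(3) w(3) st)
    fix \<sigma> assume "\<sigma> \<in> {s..t} - (N \<union> N')"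
    then have \<sigma>: "\<sigma> \<ge> 0" "s \<le> \<sigma>" "\<sigma> \<le> t" "\<sigma> \<notin> N" "\<sigma> \<notin> N'" using st by auto
    have bd: "norm (a \<sigma> z) \<le> L" for z using v(2) \<sigma> by auto
    have vw: "v \<sigma> \<in> Convess (a \<sigma>) (Z \<sigma> x)" "w \<sigma> \<in> Convess (a \<sigma>) (Z \<sigma> y)" using v(2) w(2) \<sigma> by auto
    show "norm (v \<sigma> - w \<sigma>) \<le> 2 * L"
      using norm_triangle_ineq4[of "v \<sigma>" "w \<sigma>"] norm_Convess_le[OF vw(1) bd] norm_Convess_le[OF vw(2) bd] by simp
    show "(v \<sigma> - w \<sigma>) \<bullet> (Z \<sigma> x - Z \<sigma> y) \<le> \<alpha> \<sigma> * (norm (Z \<sigma> x - Z \<sigma> y))\<^sup>2"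
      using one_sided_Lipschitz_Convess_Convess[OF oslD bd \<alpha>_nonneg vw(2,1)] \<sigma> by simp
    have "norm ((Z \<sigma> x - Z s x) - (Z \<sigma> y - Z s y)) \<le> L * (\<sigma> - s) + L * (\<sigma> - s)"
      by (rule order_trans[OF norm_triangle_ineq4]) (intro add_mono flow_Lipschitz_time st \<sigma>)
    also have "\<dots> \<le> h" using \<sigma> L_nonneg by (simp add: h_def mult_left_mono)
    finally show "norm (Z \<sigma> x - Z \<sigma> y - (Z s x - Z s y)) \<le> h" by (simp add: algebra_simps)
  qed (use st L_nonneg \<alpha>_nonneg \<alpha>_integrable v(1) w(1) in \<open>auto simp: h_def\<close>)
  moreover have "2 * (2 * L) * h * (t - s) + (2 * L)\<^sup>2 * (t - s)\<^sup>2 = 12 * L\<^sup>2 * (t - s)\<^sup>2"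
    by (simp add: h_def power2_eq_square)
  ultimately show ?thesis by simp
qed

text \<open>Discrete Gronwall over \<open>n\<close> equal steps: the error per step is of order
  1/n^2, so the total error is of order 1/n and disappears in the limit, together with the added
  square. The exponent is twice the sharp one, a loss inherited from \<open>norm_sq_step\<close>;
  the lemma serves for continuity in \<open>x\<close>, which any constant gives.\<close>

lemma flow_Lipschitz_space:
  assumes T: "0 \<le> T"
  shows "norm (Z T x - Z T y) \<le> exp (2 * integral {0..T} \<alpha>) * norm (x - y)"
proof -
  define B where "B = exp (4 * integral {0..T} \<alpha>)"
  have "(norm (Z T x - Z T y))\<^sup>2 \<le> B * ((norm (x - y))\<^sup>2 + (2 * L * T * r)\<^sup>2 + 12 * (L * T)\<^sup>2 * r)"
    if r: "\<exists>n. r = inverse (real (Suc n))" for r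
  proof -
    obtain m where "r = inverse (real (Suc m))" using r by blast
    then obtain n where n: "r = 1 / real n" "n > 0" by (metis inverse_eq_divide zero_less_Suc)
    define \<tau> where "\<tau> = T / n"
    have \<tau>: "\<tau> \<ge> 0" "n * \<tau> = T" using n T by (auto simp: \<tau>_def)
    define h where "h = 2 * L * \<tau>"
    define e where "e j = (norm (Z (j * \<tau>) x - Z (j * \<tau>) y))\<^sup>2 + h\<^sup>2" for j :: nat
    define \<delta> where "\<delta> j = 4 * integral {j * \<tau>..(Suc j) * \<tau>} \<alpha>" for j :: nat
    have "e n \<le> exp (\<Sum>j<n. \<delta> j) * (e 0 + n * (12 * L\<^sup>2 * \<tau>\<^sup>2))"
    proof (rule discrete_Gronwall)
      fix j
      have "0 \<le> real j * \<tau>" "real j * \<tau> \<le> real (Suc j) * \<tau>" "real (Suc j) * \<tau> - real j * \<tau> = \<tau>"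
        using \<tau> by (auto simp: algebra_simps)
      from flow_contraction_step[OF this(1,2), of x y, unfolded this(3)]
      show "e (Suc j) \<le> (1 + \<delta> j) * e j + 12 * L\<^sup>2 * \<tau>\<^sup>2"
        by (simp add: e_def \<delta>_def h_def)
      show "0 \<le> \<delta> j" using \<alpha>_integral_nonneg \<tau> by (simp add: \<delta>_def)
    qed (auto simp: e_def)
    also have "(\<Sum>j<k. \<delta> j) = 4 * integral {0..k * \<tau>} \<alpha>" for k
    proof (induction k)
      case (Suc k)
      have "integral {0..k * \<tau>} \<alpha> + integral {k * \<tau>..(Suc k) * \<tau>} \<alpha> = integral {0..(Suc k) * \<tau>} \<alpha>"
        using \<tau> by (intro \<alpha>_integral_combine) (auto simp: algebra_simps)
      then show ?case using Suc by (simp add: \<delta>_def)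
    qed simp
    finally have "e n \<le> B * (e 0 + n * (12 * L\<^sup>2 * \<tau>\<^sup>2))" by (simp add: \<tau> B_def)
    moreover have "n * (12 * L\<^sup>2 * \<tau>\<^sup>2) = 12 * (L * T)\<^sup>2 * r"
      using n by (simp add: \<tau>_def power2_eq_square)
    moreover have "h = 2 * L * T * r" by (simp add: h_def \<tau>_def n)
    moreover have "(norm (Z T x - Z T y))\<^sup>2 \<le> e n" by (simp add: e_def \<tau>)
    ultimately show ?thesis by (simp add: e_def)
  qed
  note bound = this
  have "(norm (Z T x - Z T y))\<^sup>2 \<le> B * ((norm (x - y))\<^sup>2 + (2 * L * T * 0)\<^sup>2 + 12 * (L * T)\<^sup>2 * 0)"
  proof (rule tendsto_lowerbound)
    show "((\<lambda>n. B * ((norm (x - y))\<^sup>2 + (2 * L * T * inverse (real (Suc n)))\<^sup>2 + 12 * (L * T)\<^sup>2 * inverse (real (Suc n))))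
      \<longlongrightarrow> B * ((norm (x - y))\<^sup>2 + (2 * L * T * 0)\<^sup>2 + 12 * (L * T)\<^sup>2 * 0)) sequentially"
      by (intro tendsto_intros LIMSEQ_inverse_real_of_nat)
  qed (use bound in auto)
  also have "\<dots> = (exp (2 * integral {0..T} \<alpha>) * norm (x - y))\<^sup>2"
    by (simp add: B_def power_mult_distrib flip: exp_double)
  finally show ?thesis by (rule power2_le_imp_le) simp
qed

text \<open>\<open>distr\<close> is the pushforward only along a measurable map.\<close>

lemma flow_borel_measurable:
  assumes "0 \<le> T" shows "Z T \<in> borel_measurable borel"
proof (rule borel_measurable_continuous_onI)
  show "continuous_on UNIV (Z T)"
    by (rule lipschitz_on_continuous_on[of "exp (2 * integral {0..T} \<alpha>)"])
       (auto simp: lipschitz_on_def dist_norm intro: flow_Lipschitz_space[OF assms])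
qed

text \<open>Only the flow moves while \<open>X\<close> is frozen, so the separation changes by at
  most \<open>L * (t - s)\<close>, hence by at most \<open>h\<close>. The constant 8 is 4 + 4, where
  the second half dominates the squared change
  \<open>(2 * L)\<^sup>2 * (t - s)\<^sup>2\<close>.\<close>

lemma scheme_flow_step:
  assumes st: "0 \<le> s" "s \<le> t" and h: "L * (t - s) \<le> h"
  shows "(norm (X + (LINT \<sigma>:{s..t}|lebesgue. a \<sigma> X) - Z t x))\<^sup>2 + h\<^sup>2
     \<le> (1 + 4 * integral {s..t} \<alpha>) * ((norm (X - Z s x))\<^sup>2 + h\<^sup>2) + 8 * L * h * (t - s)"
proof -
  obtain v N where v: "negligible N"
    "\<And>t. t \<ge> 0 \<Longrightarrow> t \<notin> N \<Longrightarrow> (\<forall>x. norm (a t x) \<le> L) \<and> v t \<in> Convess (a t) (Z t x)"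
    "\<And>s t. 0 \<le> s \<Longrightarrow> s \<le> t \<Longrightarrow> (v has_integral (Z t x - Z s x)) {s..t}"
    by (rule flow_velocity[of x]) blast
  have h0: "h \<ge> 0" using h L_nonneg st by (meson order_trans mult_nonneg_nonneg diff_ge_0_iff_ge)
  have "(norm ((X - Z s x) + ((LINT \<sigma>:{s..t}|lebesgue. a \<sigma> X) - (Z t x - Z s x))))\<^sup>2 + h\<^sup>2 \<le>
      (1 + 4 * integral {s..t} \<alpha>) * ((norm (X - Z s x))\<^sup>2 + h\<^sup>2)
      + 2 * (2 * L) * h * (t - s) + (2 * L)\<^sup>2 * (t - s)\<^sup>2"
  proof (rule norm_sq_step[where N = N and u = "\<lambda>\<sigma>. a \<sigma> X - v \<sigma>" and \<zeta> = "\<lambda>\<sigma>. X - Z \<sigma> x"])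
    show "((\<lambda>\<sigma>. a \<sigma> X - v \<sigma>) has_integral (LINT \<sigma>:{s..t}|lebesgue. a \<sigma> X) - (Z t x - Z s x)) {s..t}"
      by (intro has_integral_diff v(3) velocity_has_integral st)
    fix \<sigma> assume "\<sigma> \<in> {s..t} - N"
    then have \<sigma>: "\<sigma> \<ge> 0" "s \<le> \<sigma>" "\<sigma> \<le> t" "\<sigma> \<notin> N" using st by auto
    have bd: "norm (a \<sigma> z) \<le> L" for z using v(2) \<sigma> by auto
    have vw: "v \<sigma> \<in> Convess (a \<sigma>) (Z \<sigma> x)" using v(2) \<sigma> by auto
    show "norm (a \<sigma> X - v \<sigma>) \<le> 2 * L"
      using norm_triangle_ineq4[of "a \<sigma> X" "v \<sigma>"] norm_Convess_le[OF vw bd] bd[of X] by simp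
    show "(a \<sigma> X - v \<sigma>) \<bullet> (X - Z \<sigma> x) \<le> \<alpha> \<sigma> * (norm (X - Z \<sigma> x))\<^sup>2"
      using one_sided_Lipschitz_Convess[of "a \<sigma> X" "a \<sigma>" X "\<alpha> \<sigma>" L "v \<sigma>" "Z \<sigma> x"] oslD bd \<alpha>_nonneg vw \<sigma> by simp
    have "norm (Z \<sigma> x - Z s x) \<le> L * (\<sigma> - s)" by (intro flow_Lipschitz_time st \<sigma>)
    also have "\<dots> \<le> L * (t - s)" using \<sigma> L_nonneg by (simp add: mult_left_mono)
    finally show "norm (X - Z \<sigma> x - (X - Z s x)) \<le> h" using h by (simp add: norm_minus_commute)
  qed (use st L_nonneg \<alpha>_nonneg \<alpha>_integrable v(1) h0 in auto)
  moreover have "2 * (2 * L) * h * \<tau> + (2 * L)\<^sup>2 * \<tau>\<^sup>2 \<le> 8 * L * h * \<tau>" if "\<tau> \<ge> 0" "L * \<tau> \<le> h" for \<tau>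
    using mult_left_mono[OF that(2), of "4 * L * \<tau>"] that(1) L_nonneg by (simp add: power2_eq_square mult_ac)
  from this[of "t - s"] have "2 * (2 * L) * h * (t - s) + (2 * L)\<^sup>2 * (t - s)\<^sup>2 \<le> 8 * L * h * (t - s)"
    using st h by simp
  ultimately show ?thesis by (simp add: algebra_simps)
qed

end

section \<open>Moments of one random step\<close>

text \<open>Coefficient of the quadratic remainder of (1 + s)^k for s between -1 and 8.
  Multiplication by 1 + s creates \<open>k * s\<^sup>2\<close> from the linear term and enlarges the
  old remainder at most 9 times.\<close>

primrec binom_remainder :: "nat \<Rightarrow> real" where
  "binom_remainder 0 = 0"
| "binom_remainder (Suc k) = k + 9 * binom_remainder k"

lemma binom_remainder_nonneg: "binom_remainder k \<ge> 0"
  by (induction k) auto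

text \<open>The lower bound on \<open>s\<close> keeps the factor 1 + s non-negative in the
  induction; the upper bound 8 is the largest relative growth of the squared distance that a jump
  causes in \<open>centered_moment_le\<close>.\<close>

lemma power_le_second_order:
  assumes "-1 \<le> s" "s \<le> 8"
  shows "(1 + s) ^ k \<le> 1 + k * s + binom_remainder k * s\<^sup>2"
proof (induction k)
  case (Suc k)
  have "(1 + s) ^ Suc k \<le> (1 + s) * (1 + k * s + binom_remainder k * s\<^sup>2)"
    using Suc assms by (simp add: mult_left_mono)
  also have "\<dots> = 1 + Suc k * s + k * s\<^sup>2 + (1 + s) * (binom_remainder k * s\<^sup>2)"
    by (simp add: algebra_simps power2_eq_square)
  also have "(1 + s) * (binom_remainder k * s\<^sup>2) \<le> 9 * (binom_remainder k * s\<^sup>2)"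
    using assms binom_remainder_nonneg by (intro mult_right_mono) auto
  finally show ?case by (simp add: algebra_simps)
qed simp

text \<open>The 1 pays for the linear term of the expansion; 16 is the square of the 4 in the bound
  \<open>4 * sqrt T * norm (m j)\<close> on an increment.\<close>

definition moment_const :: "nat \<Rightarrow> real" where
  "moment_const k = 1 + 16 * binom_remainder k"

lemma moment_const_pos: "moment_const k > 0"
  using binom_remainder_nonneg[of k] by (simp add: moment_const_def)

text \<open>A jump \<open>m\<close> adds \<xi> = 2 (w \<bullet> m) + |m|^2 to T = |w|^2 + h^2 + r.
  Since the jumps are centred, the mean of \<xi> is at most \<open>v\<close>; since |\<xi>| \<le> 4
  sqrt(T) |m|, the mean of its square is at most 16 T v. The summand h^2 ensures h \<le> sqrt(T), so
  that \<xi>/T stays bounded even when \<open>w\<close> is small.\<close>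

lemma centered_moment_le:
  fixes m :: "'i \<Rightarrow> 'a::real_inner"
  assumes I: "finite I" and p: "\<And>j. j \<in> I \<Longrightarrow> p j \<ge> 0" "sum p I = 1"
    and mean: "(\<Sum>j\<in>I. p j *\<^sub>R m j) = 0" and m: "\<And>j. j \<in> I \<Longrightarrow> norm (m j) \<le> 2 * h"
    and var: "(\<Sum>j\<in>I. p j * (norm (m j))\<^sup>2) \<le> v" and h: "h > 0" and r: "r \<ge> 0"
  shows "(\<Sum>j\<in>I. p j * ((norm (w + m j))\<^sup>2 + h\<^sup>2 + r) ^ k) \<le> ((norm w)\<^sup>2 + h\<^sup>2 + r + moment_const k * v) ^ k"
proof -
  define T where "T = (norm w)\<^sup>2 + h\<^sup>2 + r"
  have T: "h\<^sup>2 \<le> T" "(norm w)\<^sup>2 \<le> T" using r by (simp_all add: T_def)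
  have "0 < h\<^sup>2" using h by simp
  with T(1) have T0: "T > 0" by linarith
  note T = T0 T
  have hT: "h \<le> sqrt T" using T(2) real_le_rsqrt by blast
  have wT: "norm w \<le> sqrt T" using T(3) real_le_rsqrt by blast
  have sT: "sqrt T * sqrt T = T" using T by simp
  have v0: "v \<ge> 0" by (rule order_trans[OF sum_nonneg var]) (use p in auto)
  define \<xi> where "\<xi> j = 2 * (w \<bullet> m j) + (norm (m j))\<^sup>2" for j
  have exp: "(norm (w + m j))\<^sup>2 + h\<^sup>2 + r = T + \<xi> j" for j
    by (simp add: T_def \<xi>_def power2_norm_eq_inner inner_simps inner_commute)
  have \<xi>4: "\<bar>\<xi> j\<bar> \<le> 4 * sqrt T * norm (m j)" if "j \<in> I" for j
  proof -
    have "\<bar>\<xi> j\<bar> \<le> 2 * \<bar>w \<bullet> m j\<bar> + norm (m j) * norm (m j)" by (simp add: \<xi>_def power2_eq_square abs_if)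
    also have "\<dots> \<le> 2 * (sqrt T * norm (m j)) + (2 * sqrt T) * norm (m j)"
    proof (intro add_mono mult_left_mono mult_right_mono)
      show "\<bar>w \<bullet> m j\<bar> \<le> sqrt T * norm (m j)"
        by (rule order_trans[OF Cauchy_Schwarz_ineq2]) (simp add: mult_right_mono wT)
      show "norm (m j) \<le> 2 * sqrt T" using m[OF that] hT by simp
    qed auto
    finally show ?thesis by simp
  qed
  have summand: "p j * (T + \<xi> j) ^ k \<le> T ^ k * (p j + k / T * (p j * \<xi> j) + 16 * binom_remainder k / T * (p j * (norm (m j))\<^sup>2))"
    if j: "j \<in> I" for j
  proof -
    have "4 * sqrt T * norm (m j) \<le> 4 * sqrt T * (2 * sqrt T)"
      using m[OF j] hT T by (intro mult_left_mono) auto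
    also have "\<dots> = 8 * T" using sT by simp
    finally have "\<bar>\<xi> j\<bar> \<le> 8 * T" using \<xi>4[OF j] by linarith
    then have u: "\<xi> j / T \<le> 8" using T by (simp add: divide_le_eq)
    have "0 \<le> T + \<xi> j" unfolding exp[symmetric] using r by simp
    then have l: "-1 \<le> \<xi> j / T" using T by (simp add: le_divide_eq)
    have sq: "(\<xi> j / T)\<^sup>2 \<le> 16 / T * (norm (m j))\<^sup>2"
    proof -
      have "(\<xi> j)\<^sup>2 \<le> (4 * sqrt T * norm (m j))\<^sup>2"
        using power_mono[OF \<xi>4[OF j], of 2] by simp
      also have "\<dots> = 16 * T * (norm (m j))\<^sup>2" using T by (simp add: power_mult_distrib)
      finally show ?thesis using T by (simp add: power_divide power2_eq_square field_simps)
    qed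
    have "(T + \<xi> j) ^ k = T ^ k * (1 + \<xi> j / T) ^ k"
      using T by (simp add: field_simps flip: power_mult_distrib)
    also have "\<dots> \<le> T ^ k * (1 + k * (\<xi> j / T) + binom_remainder k * (\<xi> j / T)\<^sup>2)"
      using T by (intro mult_left_mono power_le_second_order l u) auto
    also have "\<dots> \<le> T ^ k * (1 + k * (\<xi> j / T) + binom_remainder k * (16 / T * (norm (m j))\<^sup>2))"
      using T sq binom_remainder_nonneg by (intro mult_left_mono add_left_mono) auto
    finally show ?thesis using p(1)[OF j] mult_left_mono[of _ _ "p j"] by (fastforce simp: algebra_simps)
  qed
  have "(\<Sum>j\<in>I. p j * \<xi> j) = 2 * (w \<bullet> (\<Sum>j\<in>I. p j *\<^sub>R m j)) + (\<Sum>j\<in>I. p j * (norm (m j))\<^sup>2)"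
    by (simp add: \<xi>_def inner_sum_right sum_distrib_left sum.distrib algebra_simps)
  then have \<xi>v: "(\<Sum>j\<in>I. p j * \<xi> j) \<le> v" using mean var by simp
  have "(\<Sum>j\<in>I. p j * ((norm (w + m j))\<^sup>2 + h\<^sup>2 + r) ^ k) \<le>
     (\<Sum>j\<in>I. T ^ k * (p j + k / T * (p j * \<xi> j) + 16 * binom_remainder k / T * (p j * (norm (m j))\<^sup>2)))"
    unfolding exp by (intro sum_mono summand)
  also have "\<dots> = T ^ k * (1 + k / T * (\<Sum>j\<in>I. p j * \<xi> j) + 16 * binom_remainder k / T * (\<Sum>j\<in>I. p j * (norm (m j))\<^sup>2))"
    by (simp only: sum_distrib_left[symmetric] sum.distrib p(2))
  also have "\<dots> \<le> T ^ k * (1 + k / T * v + 16 * binom_remainder k / T * v)"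
    using T \<xi>v var binom_remainder_nonneg by (intro mult_left_mono add_mono) auto
  also have "\<dots> \<le> T ^ k * (1 + k * (moment_const k * v / T))"
  proof (intro mult_left_mono)
    \<comment> \<open>A factor \<open>k\<close> has to be pulled out for Bernoulli's inequality; for
      \<open>k = 0\<close> the remainder vanishes.\<close>
    have "binom_remainder k \<le> k * binom_remainder k"
      using mult_right_mono[of 1 "real k" "binom_remainder k"] binom_remainder_nonneg[of k] by (cases "k = 0") auto
    then have "(k + 16 * binom_remainder k) * (v / T) \<le> (k * moment_const k) * (v / T)"
      using v0 T by (intro mult_right_mono) (auto simp: moment_const_def algebra_simps)
    then show "1 + k / T * v + 16 * binom_remainder k / T * v \<le> 1 + k * (moment_const k * v / T)"
      by (simp add: algebra_simps add_divide_distrib)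
  qed (use T in auto)
  \<comment> \<open>Bernoulli's inequality restores a pure power, the form that the next step of the
    walk can take up.\<close>
  also have "\<dots> \<le> T ^ k * (1 + moment_const k * v / T) ^ k"
    using T v0 moment_const_pos[of k]
    by (intro mult_left_mono Bernoulli_inequality) (auto intro: order_trans[of _ 0])
  also have "\<dots> = (T + moment_const k * v) ^ k"
    using T by (simp add: field_simps flip: power_mult_distrib)
  finally show ?thesis by (simp add: T_def)
qed

section \<open>One step of the walk: probabilities, mean and variance\<close>

lemma sum_UNIV_moves:
  "(\<Sum>z\<in>(UNIV :: ('d::finite \<times> bool) option set). f z) =
     f None + (\<Sum>i\<in>UNIV. f (Some (i, True)) + f (Some (i, False)))"
proof -
  have "(\<Sum>z\<in>(UNIV :: ('d \<times> bool) option set). f z) = f None + (\<Sum>z\<in>UNIV. f (Some z))"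
    by (simp add: UNIV_option_conv sum.reindex)
  also have "(\<Sum>z\<in>(UNIV :: ('d \<times> bool) set). f (Some z)) = (\<Sum>i\<in>UNIV. \<Sum>b\<in>UNIV. f (Some (i, b)))"
    by (simp add: sum.cartesian_product UNIV_Times_UNIV)
  finally show ?thesis by (simp add: UNIV_bool add.commute)
qed

text \<open>A move of the random walk is \<open>None\<close> (stay) or \<open>Some (i, b)\<close> (one cell forward or backward along \<open>e\<^sub>i\<close>).\<close>

primrec index_move :: "('d \<times> bool) option \<Rightarrow> int ^ 'd" where
  "index_move None = 0"
| "index_move (Some z) = (if snd z then axis (fst z) 1 else - axis (fst z) 1)"

primrec space_move :: "real ^ 'd \<Rightarrow> ('d \<times> bool) option \<Rightarrow> real ^ 'd" where
  "space_move dx None = 0"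
| "space_move dx (Some z) = (if snd z then 1 else -1) *\<^sub>R axis (fst z) (dx $ fst z)"

primrec move_prob :: "real \<Rightarrow> real ^ 'd \<Rightarrow> ('d \<Rightarrow> real) \<Rightarrow> ('d \<times> bool) option \<Rightarrow> real" where
  "move_prob dt dx b None = 1 - (\<Sum>i\<in>UNIV. dt / dx $ i * \<bar>b i\<bar>)"
| "move_prob dt dx b (Some z) =
     dt / dx $ fst z * (if snd z then pos_part (b (fst z)) else neg_part (b (fst z)))"

lemma pos_neg_part: "pos_part x + neg_part x = \<bar>x\<bar>" "pos_part x - neg_part x = x"
  "pos_part x \<ge> 0" "neg_part x \<ge> 0"
  by (auto simp: pos_part_def neg_part_def)

lemma grid_point_add_move: "grid_point dx (J + index_move z) = grid_point dx J + space_move dx z"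
  by (cases z) (auto simp: grid_point_def vec_eq_iff axis_def algebra_simps)

lemma sum_move_prob: "(\<Sum>z\<in>UNIV. move_prob dt dx b z) = 1"
  by (simp add: sum_UNIV_moves distrib_left add_divide_distrib flip: pos_neg_part(1))

text \<open>The CFL condition enters through the probability of staying, which is what the outflow
  in all directions leaves over.\<close>

lemma move_prob_nonneg:
  fixes dx :: "real ^ 'd" and dt L :: real
  assumes "dt > 0" "\<And>i. dx $ i > 0" "\<And>i. \<bar>b i\<bar> \<le> L" "L * (\<Sum>i\<in>UNIV. dt / dx $ i) \<le> 1"
  shows "move_prob dt dx b z \<ge> 0"
proof (cases z)
  case None
  have "(\<Sum>i\<in>UNIV. dt / dx $ i * \<bar>b i\<bar>) \<le> (\<Sum>i\<in>UNIV. dt / dx $ i * L)"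
    using assms(1-3) by (intro sum_mono mult_left_mono) (auto intro: less_imp_le)
  also have "\<dots> \<le> 1" using assms(4) by (simp add: sum_distrib_left mult.commute)
  finally show ?thesis using None by simp
next
  case (Some y)
  then show ?thesis using assms(1,2) by (auto intro!: mult_nonneg_nonneg divide_nonneg_pos simp: pos_neg_part less_imp_le)
qed

text \<open>The jump length cancels the weight 1/dx_i, and positive minus negative part is b_i. The
  walk thus has the right drift on average without any bias, and only its fluctuations remain to be
  controlled.\<close>

lemma mean_space_move:
  fixes dx :: "real ^ 'd"
  assumes "\<And>i. dx $ i > 0"
  shows "(\<Sum>z\<in>UNIV. move_prob dt dx b z *\<^sub>R space_move dx z) = dt *\<^sub>R (\<chi> i. b i)"
proof -
  have "(\<Sum>z\<in>UNIV. move_prob dt dx b z *\<^sub>R space_move dx z) = (\<Sum>i\<in>UNIV. (dt * b i) *\<^sub>R axis i 1)"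
    unfolding sum_UNIV_moves
  proof (simp, intro sum.cong refl)
    fix i
    have "axis i (dx $ i) = dx $ i *\<^sub>R (axis i 1 :: real ^ 'd)" by (simp add: vec_eq_iff axis_def)
    moreover have "dt / dx $ i * pos_part (b i) * dx $ i - dt / dx $ i * neg_part (b i) * dx $ i = dt * b i"
      using assms[of i] pos_neg_part(2)[of "b i"] by (simp add: field_simps flip: right_diff_distrib)
    ultimately show "(dt * pos_part (b i) / dx $ i) *\<^sub>R axis i (dx $ i) -
         (dt * neg_part (b i) / dx $ i) *\<^sub>R axis i (dx $ i) = (dt * b i) *\<^sub>R axis i 1"
      by (simp flip: scaleR_left_diff_distrib)
  qed
  also have "\<dots> = dt *\<^sub>R (\<chi> i. b i)"
    by (simp add: vec_eq_iff axis_def if_distrib[of "\<lambda>x. _ * x"] cong: if_cong)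
  finally show ?thesis .
qed

lemma norm_axis_real: "norm (axis i x :: real ^ 'd) = \<bar>x\<bar>"
  by (simp add: norm_eq_sqrt_inner inner_axis_axis)

text \<open>A jump along e_i has probability |b_i| dt/dx_i and squared length dx_i^2. The resulting
  order dt * h, instead of h^2, is the source of the term sqrt(t h) in the rate.\<close>

lemma variance_space_move:
  fixes dx :: "real ^ 'd" and dt L h :: real
  assumes "dt > 0" "\<And>i. dx $ i > 0" "\<And>i. dx $ i \<le> h" "\<And>i. \<bar>b i\<bar> \<le> L"
  shows "(\<Sum>z\<in>UNIV. move_prob dt dx b z * (norm (space_move dx z))\<^sup>2) \<le> CARD('d) * (L * h * dt)"
proof -
  have "(\<Sum>z\<in>UNIV. move_prob dt dx b z * (norm (space_move dx z))\<^sup>2) = (\<Sum>i\<in>UNIV. \<bar>b i\<bar> * dx $ i * dt)"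
    unfolding sum_UNIV_moves
  proof (simp add: norm_axis_real, intro sum.cong refl)
    fix i
    show "dt * pos_part (b i) * (dx $ i)\<^sup>2 / dx $ i + dt * neg_part (b i) * (dx $ i)\<^sup>2 / dx $ i = \<bar>b i\<bar> * dx $ i * dt"
      using assms(2)[of i] by (simp add: power2_eq_square flip: pos_neg_part(1)) (simp add: algebra_simps)
  qed
  also have "\<dots> \<le> (\<Sum>i\<in>(UNIV :: 'd set). L * h * dt)"
  proof (intro sum_mono mult_mono)
    fix i
    have "0 \<le> L" "0 \<le> h" using order_trans[OF abs_ge_zero assms(4)] order_trans[OF less_imp_le assms(3)] assms(2) by blast+
    then show "0 \<le> L * h" "0 \<le> L" by auto
  qed (use assms in \<open>auto intro: less_imp_le\<close>)
  finally show ?thesis by simp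
qed

text \<open>\<open>centered_moment_le\<close> for the jumps minus their mean \<open>c\<close>: both
  are at most \<open>h\<close> in norm, which accounts for the bound \<open>2 * h\<close>.\<close>

lemma move_moment_le:
  fixes dx X :: "real ^ 'd" and dt L h :: real
  assumes dt: "dt > 0" and dx: "\<And>i. dx $ i > 0" "\<And>i. dx $ i \<le> h"
    and b: "norm (\<chi> i. b i) \<le> L" and cfl: "L * (\<Sum>i\<in>UNIV. dt / dx $ i) \<le> 1" and r: "r \<ge> 0"
    and Ldt: "L * dt \<le> h"
  shows "(\<Sum>z\<in>UNIV. move_prob dt dx b z * ((norm (X + space_move dx z - y))\<^sup>2 + h\<^sup>2 + r) ^ k)
    \<le> ((norm (X + dt *\<^sub>R (\<chi> i. b i) - y))\<^sup>2 + h\<^sup>2 + r + moment_const k * (CARD('d) * (L * h * dt))) ^ k"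
proof -
  define c where "c = dt *\<^sub>R (\<chi> i. b i)"
  have bi: "\<bar>b i\<bar> \<le> L" for i using component_le_norm_cart[of "\<chi> i. b i" i] b by simp
  note p0 = move_prob_nonneg[OF dt dx(1) bi cfl]
  have h: "h > 0" using dx less_le_trans by blast
  have "norm c \<le> dt * L" unfolding c_def using dt b by (simp add: mult_left_mono)
  then have c: "norm c \<le> h" using Ldt by (simp add: mult.commute)
  have "(\<Sum>z\<in>UNIV. move_prob dt dx b z * ((norm ((X + c - y) + (space_move dx z - c)))\<^sup>2 + h\<^sup>2 + r) ^ k)
     \<le> ((norm (X + c - y))\<^sup>2 + h\<^sup>2 + r + moment_const k * (CARD('d) * (L * h * dt))) ^ k"
  proof (rule centered_moment_le[OF _ p0 sum_move_prob _ _ _ h r])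
    show "(\<Sum>z\<in>UNIV. move_prob dt dx b z *\<^sub>R (space_move dx z - c)) = 0"
    proof -
      have "(\<Sum>z\<in>UNIV. move_prob dt dx b z *\<^sub>R (space_move dx z - c)) =
          (\<Sum>z\<in>UNIV. move_prob dt dx b z *\<^sub>R space_move dx z) - (\<Sum>z\<in>UNIV. move_prob dt dx b z) *\<^sub>R c"
        by (simp add: scaleR_right_diff_distrib sum_subtractf scaleR_sum_left)
      then show ?thesis by (simp only: mean_space_move[OF dx(1)] sum_move_prob c_def) simp
    qed
    show "norm (space_move dx z - c) \<le> 2 * h" for z :: "('d \<times> bool) option"
    proof -
      have "norm (space_move dx z) \<le> h"
        using h dx by (cases z) (auto simp: norm_axis_real abs_of_pos[OF dx(1)] dx(2))
      then show ?thesis using c norm_triangle_ineq4[of "space_move dx z" c] by simp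
    qed
    \<comment> \<open>Second moment minus squared mean: centring can only decrease the second
      moment.\<close>
    have "(\<Sum>z\<in>UNIV. move_prob dt dx b z * (norm (space_move dx z - c))\<^sup>2)
       = (\<Sum>z\<in>UNIV. move_prob dt dx b z * (norm (space_move dx z))\<^sup>2)
         - 2 * ((\<Sum>z\<in>UNIV. move_prob dt dx b z *\<^sub>R space_move dx z) \<bullet> c)
         + (\<Sum>z\<in>UNIV. move_prob dt dx b z) * (norm c)\<^sup>2"
    proof -
      have "move_prob dt dx b z * (norm (space_move dx z - c))\<^sup>2 = move_prob dt dx b z * (norm (space_move dx z))\<^sup>2
          - 2 * ((move_prob dt dx b z *\<^sub>R space_move dx z) \<bullet> c) + move_prob dt dx b z * (norm c)\<^sup>2" for z
        by (simp add: power2_norm_eq_inner inner_simps inner_commute algebra_simps)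
      then show ?thesis
        by (simp only: sum.distrib sum_subtractf inner_sum_left sum_distrib_left sum_distrib_right)
    qed
    also have "\<dots> = (\<Sum>z\<in>UNIV. move_prob dt dx b z * (norm (space_move dx z))\<^sup>2) - (norm c)\<^sup>2"
      unfolding mean_space_move[OF dx(1)] sum_move_prob c_def[symmetric] by (simp add: power2_norm_eq_inner)
    also have "\<dots> \<le> CARD('d) * (L * h * dt)"
      using variance_space_move[of dt dx h b L, OF dt dx bi] zero_le_power2[of "norm c"] by linarith
    finally show "(\<Sum>z\<in>UNIV. move_prob dt dx b z * (norm (space_move dx z - c))\<^sup>2) \<le> CARD('d) * (L * h * dt)" .
  qed auto
  then show ?thesis by (simp add: c_def algebra_simps)
qed

section \<open>The random walk of the upwind scheme\<close>

text \<open>The outflow terms carry the weight |b_i|, the sum of positive and negative part, and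
  merge with the old mass into the probability of staying. All velocities are taken at the node of
  departure.\<close>

lemma upwind_Suc_moves:
  "upwind a dt dx \<rho> (Suc n) J =
     (\<Sum>z\<in>UNIV. move_prob dt dx (mean_velocity a dt dx n (J - index_move z)) z
        * upwind a dt dx \<rho> n (J - index_move z))"
  unfolding sum_UNIV_moves
  by (simp add: algebra_simps sum.distrib sum_subtractf sum_distrib_left flip: pos_neg_part(1))

lemma nn_integral_count_space_shift:
  fixes f :: "'a::group_add \<Rightarrow> ennreal"
  shows "(\<integral>\<^sup>+J. f (J + s) \<partial>count_space UNIV) = (\<integral>\<^sup>+J. f J \<partial>count_space UNIV)"
proof (rule nn_integral_bij_count_space)
  show "bij_betw (\<lambda>J. J + s) UNIV UNIV"
    by (rule bij_betwI[where g = "\<lambda>J. J - s"]) auto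
qed

text \<open>An index shift for each move transfers the step from the weights to the test function;
  with values in \<open>ennreal\<close> no summability question arises.\<close>

lemma forward_backward_duality:
  fixes w :: "'a::group_add \<Rightarrow> real" and f :: "'a \<Rightarrow> ennreal"
  assumes "finite I" "\<And>J. w J \<ge> 0" "\<And>J z. q J z \<ge> 0"
  shows "(\<integral>\<^sup>+J. ennreal (\<Sum>z\<in>I. q (J - s z) z * w (J - s z)) * f J \<partial>count_space UNIV)
     = (\<integral>\<^sup>+J. ennreal (w J) * (\<Sum>z\<in>I. ennreal (q J z) * f (J + s z)) \<partial>count_space UNIV)"
proof -
  have "(\<integral>\<^sup>+J. ennreal (\<Sum>z\<in>I. q (J - s z) z * w (J - s z)) * f J \<partial>count_space UNIV)
     = (\<Sum>z\<in>I. \<integral>\<^sup>+J. ennreal (q (J - s z) z * w (J - s z)) * f J \<partial>count_space UNIV)"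
    using assms by (simp add: sum_distrib_right nn_integral_sum flip: sum_ennreal)
  also have "\<dots> = (\<Sum>z\<in>I. \<integral>\<^sup>+J. ennreal (q J z * w J) * f (J + s z) \<partial>count_space UNIV)"
  proof (rule sum.cong)
    fix z
    show "(\<integral>\<^sup>+J. ennreal (q (J - s z) z * w (J - s z)) * f J \<partial>count_space UNIV)
        = (\<integral>\<^sup>+J. ennreal (q J z * w J) * f (J + s z) \<partial>count_space UNIV)"
      using nn_integral_count_space_shift[of "\<lambda>J. ennreal (q (J - s z) z * w (J - s z)) * f J" "s z"] by simp
  qed simp
  also have "\<dots> = (\<integral>\<^sup>+J. ennreal (w J) * (\<Sum>z\<in>I. ennreal (q J z) * f (J + s z)) \<partial>count_space UNIV)"
    using assms by (simp add: sum_distrib_left nn_integral_sum ennreal_mult mult_ac)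
  finally show ?thesis .
qed

section \<open>Cells and nearest grid points\<close>

lemma cell_borel: "cell dx J \<in> sets borel" for dx :: "real ^ 'd"
proof -
  have "cell dx J = (\<Inter>i. {x. x $ i \<in> {(of_int (J $ i) - 1/2) * dx $ i ..< (of_int (J $ i) + 1/2) * dx $ i}})"
    by (auto simp: cell_def)
  also have "\<dots> \<in> sets borel"
  proof (rule sets.finite_INT)
    fix i
    have "(\<lambda>x. x $ i) \<in> borel_measurable (borel :: (real ^ 'd) measure)"
      by (intro borel_measurable_continuous_onI continuous_intros)
    from measurable_sets_borel[OF this, of "{(of_int (J $ i) - 1/2) * dx $ i ..< (of_int (J $ i) + 1/2) * dx $ i}"]
    show "{x. x $ i \<in> {(of_int (J $ i) - 1/2) * dx $ i ..< (of_int (J $ i) + 1/2) * dx $ i}} \<in> sets borel"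
      by (simp add: vimage_def)
  qed auto
  finally show ?thesis .
qed

text \<open>Cells are centred at grid points and closed on the left, which corresponds to rounding
  half up.\<close>

definition cell_index :: "real ^ 'd \<Rightarrow> real ^ 'd \<Rightarrow> int ^ 'd" where
  "cell_index dx x = (\<chi> i. \<lfloor>x $ i / dx $ i + 1/2\<rfloor>)"

lemma in_cell_iff:
  assumes "\<And>i. dx $ i > 0"
  shows "x \<in> cell dx J \<longleftrightarrow> J = cell_index dx x"
proof -
  have "x $ i \<in> {(of_int j - 1/2) * dx $ i ..< (of_int j + 1/2) * dx $ i} \<longleftrightarrow> j = \<lfloor>x $ i / dx $ i + 1/2\<rfloor>" for i and j :: int
    unfolding eq_commute[of j] floor_eq_iff using assms[of i] by (auto simp: field_simps)
  then show ?thesis by (simp add: cell_def cell_index_def vec_eq_iff)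
qed

lemma norm_sq_grid_point_cell:
  fixes x :: "real ^ 'd" and h :: real
  assumes "x \<in> cell dx J" and dx: "\<And>i. dx $ i > 0" "\<And>i. dx $ i \<le> h"
  shows "(norm (grid_point dx J - x))\<^sup>2 \<le> CARD('d) * h\<^sup>2"
proof -
  have "(norm (grid_point dx J - x))\<^sup>2 = (\<Sum>i\<in>UNIV. ((grid_point dx J - x) $ i)\<^sup>2)"
    by (simp only: power2_norm_eq_inner inner_vec_def) (simp add: power2_eq_square)
  also have "\<dots> \<le> (\<Sum>i\<in>(UNIV :: 'd set). h\<^sup>2)"
  proof (rule sum_mono)
    fix i
    have "x $ i \<in> {(of_int (J $ i) - 1/2) * dx $ i ..< (of_int (J $ i) + 1/2) * dx $ i}"
      using assms(1) by (simp add: cell_def)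
    then have "\<bar>(grid_point dx J - x) $ i\<bar> \<le> dx $ i"
      using dx(1)[of i] by (simp add: grid_point_def algebra_simps abs_le_iff)
    also have "\<dots> \<le> \<bar>h\<bar>" using dx(2)[of i] by simp
    finally show "((grid_point dx J - x) $ i)\<^sup>2 \<le> h\<^sup>2" by (simp add: abs_le_square_iff)
  qed
  finally show ?thesis by simp
qed

lemma le_mesh_size: "dx $ i \<le> mesh_size dx"
  by (auto simp: mesh_size_def)

text \<open>Error of one step in units of \<open>h * dt\<close>: \<open>8 * L\<close> is the drift
  error of \<open>scheme_flow_step\<close>, the rest is the variance of the jumps times the factor
  of \<open>centered_moment_le\<close>.\<close>

definition error_rate :: "real \<Rightarrow> nat \<Rightarrow> nat \<Rightarrow> real" where
  "error_rate L d k = 8 * L + moment_const k * (d * L)"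

section \<open>Moments of the walk relative to the flow\<close>

locale upwind_transport = Filippov_transport a \<alpha> Z L
  for a :: "real \<Rightarrow> real ^ 'd \<Rightarrow> real ^ 'd" and \<alpha> Z L +
  fixes dt :: real and dx :: "real ^ 'd"
  assumes dt: "dt > 0" and dx: "\<And>i. dx $ i > 0" and cfl: "L * (\<Sum>i\<in>UNIV. dt / dx $ i) \<le> 1"
begin

abbreviation h :: real where "h \<equiv> mesh_size dx"

abbreviation vel :: "nat \<Rightarrow> int ^ 'd \<Rightarrow> 'd \<Rightarrow> real" where "vel \<equiv> mean_velocity a dt dx"

text \<open>The scheme started from the Dirac mass at \<open>x\<close>: the law of the random walk after \<open>n\<close> steps.\<close>

abbreviation walk :: "nat \<Rightarrow> int ^ 'd \<Rightarrow> real ^ 'd \<Rightarrow> real" where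
  "walk n J x \<equiv> upwind a dt dx (return borel x) n J"

lemma h_pos: "h > 0" using dx le_mesh_size less_le_trans by blast

text \<open>A single summand of the CFL sum suffices. The displacement of flow and mean move within
  a step is thereby bounded by the mesh size.\<close>

lemma L_dt_le: "L * dt \<le> h"
proof -
  fix i :: 'd
  have "dt / dx $ i \<le> (\<Sum>i\<in>UNIV. dt / dx $ i)"
    by (rule member_le_sum) (use dt dx in \<open>auto intro: less_imp_le divide_nonneg_pos\<close>)
  then have "L * (dt / dx $ i) \<le> 1" using cfl L_nonneg by (meson mult_left_mono order_trans)
  then have "L * dt \<le> dx $ i" using dx[of i] by (simp add: field_simps)
  then show ?thesis using le_mesh_size order_trans by blast
qed

lemma vel_integral:
  "dt *\<^sub>R (\<chi> i. vel n J i) = (LINT s:{real n * dt .. real (n + 1) * dt}|lebesgue. a s (grid_point dx J))"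
proof (rule vec_eq_iff[THEN iffD2], rule allI)
  fix i
  let ?f = "\<lambda>s. indicat_real {real n * dt .. real (n + 1) * dt} s *\<^sub>R a s (grid_point dx J)"
  have "set_integrable lebesgue {real n * dt .. real (n + 1) * dt} (\<lambda>s. a s (grid_point dx J))"
    by (rule set_integrable_velocity[OF jm AE_bounded]) (use dt in auto)
  then have "(LINT s|lebesgue. ?f s $ i) = (LINT s|lebesgue. ?f s) $ i"
    unfolding set_integrable_def by (rule integral_bounded_linear[OF bounded_linear_vec_nth])
  moreover have "vel n J i = (1 / dt) * (LINT s|lebesgue. ?f s $ i)"
    by (simp add: mean_velocity_def set_lebesgue_integral_def)
  ultimately show "(dt *\<^sub>R (\<chi> i. vel n J i)) $ i =
      (LINT s:{real n * dt .. real (n + 1) * dt}|lebesgue. a s (grid_point dx J)) $ i"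
    using dt by (simp add: set_lebesgue_integral_def)
qed

text \<open>The Euclidean norm is bounded by \<open>L\<close> without a dimensional factor because
  the mean is taken of the vector and not of each component.\<close>

lemma norm_vel_le: "norm (\<chi> i. vel n J i) \<le> L"
proof -
  define N where "N = {t. \<not> (t \<ge> 0 \<longrightarrow> (\<forall>x. norm (a t x) \<le> L))}"
  have N: "negligible N"
    using AE_bounded by (simp add: N_def completion.AE_iff_null_sets negligible_iff_null_sets)
  define I where "I = (LINT s:{real n * dt .. real (n + 1) * dt}|lebesgue. a s (grid_point dx J))"
  have "((\<lambda>s. if s \<in> N then 0 else a s (grid_point dx J)) has_integral I) (cbox (real n * dt) (real (n + 1) * dt))"
    by (rule has_integral_spike[OF N, of _ _ "\<lambda>s. a s (grid_point dx J)"])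
       (use velocity_has_integral[of "real n * dt" "grid_point dx J" "real (n + 1) * dt"] dt in \<open>auto simp: I_def\<close>)
  then have "norm I \<le> L * measure lborel (cbox (real n * dt) (real (n + 1) * dt))"
  proof (rule has_integral_bound[OF L_nonneg])
    fix s assume s: "s \<in> cbox (real n * dt) (real (n + 1) * dt)"
    have "0 \<le> real n * dt" using dt by simp
    then have "s \<ge> 0" using s by auto
    then show "norm (if s \<in> N then 0 else a s (grid_point dx J)) \<le> L" using L_nonneg by (simp add: N_def)
  qed
  also have "\<dots> = L * dt" using dt by (simp add: algebra_simps)
  also have "norm I = dt * norm (\<chi> i. vel n J i)"
    unfolding I_def vel_integral[symmetric] using dt by simp
  finally have "dt * norm (\<chi> i. vel n J i) \<le> dt * L" by (simp add: mult.commute)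
  then show ?thesis using dt by simp
qed

lemma abs_vel_le: "\<bar>vel n J i\<bar> \<le> L"
  using component_le_norm_cart[of "\<chi> i. vel n J i" i] norm_vel_le[of n J] by simp

lemma walk_prob_nonneg: "move_prob dt dx (vel n J) z \<ge> 0"
  by (rule move_prob_nonneg[OF dt dx abs_vel_le cfl])

lemma upwind_nonneg: "upwind a dt dx \<rho> n J \<ge> 0"
proof (induction n arbitrary: J)
  case (Suc n)
  then show ?case unfolding upwind_Suc_moves by (intro sum_nonneg mult_nonneg_nonneg walk_prob_nonneg) auto
qed simp

lemma nn_integral_upwind_Suc:
  "(\<integral>\<^sup>+J. ennreal (upwind a dt dx \<rho> (Suc n) J) * f J \<partial>count_space UNIV) =
   (\<integral>\<^sup>+J. ennreal (upwind a dt dx \<rho> n J) *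
      (\<Sum>z\<in>UNIV. ennreal (move_prob dt dx (vel n J) z) * f (J + index_move z)) \<partial>count_space UNIV)"
  unfolding upwind_Suc_moves
  by (rule forward_backward_duality) (auto intro: upwind_nonneg walk_prob_nonneg)

lemma nn_integral_walk_0:
  "(\<integral>\<^sup>+J. ennreal (walk 0 J x) * f J \<partial>count_space UNIV) = f (cell_index dx x)"
proof -
  have "(\<lambda>J. ennreal (walk 0 J x) * f J) = (\<lambda>J. f (cell_index dx x) * indicator {cell_index dx x} J)"
    using in_cell_iff[OF dx] by (auto simp: measure_return cell_borel indicator_def)
  then show ?thesis by (simp add: nn_integral_cmult_indicator)
qed

lemma nn_integral_walk: "(\<integral>\<^sup>+J. ennreal (walk n J x) \<partial>count_space UNIV) = 1"
proof (induction n)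
  case 0
  then show ?case using nn_integral_walk_0[of x "\<lambda>_. 1"] by simp
next
  case (Suc n)
  have "(\<Sum>z\<in>UNIV. ennreal (move_prob dt dx (vel n J) z)) = 1" for J
    by (simp add: sum_ennreal walk_prob_nonneg sum_move_prob)
  then show ?case using nn_integral_upwind_Suc[of "return borel x" n "\<lambda>_. 1"] Suc by simp
qed

text \<open>The coefficients of the scheme do not involve the initial datum, so the scheme is linear
  in it, and \<rho> is an average of Dirac masses. Integrability is carried along because the
  integral is linear on integrable functions only.\<close>

lemma upwind_eq_integral_walk:
  assumes "prob_space \<rho>" and [measurable_cong]: "sets \<rho> = sets borel"
  shows "integrable \<rho> (walk n J) \<and> upwind a dt dx \<rho> n J = (LINT x|\<rho>. walk n J x)"
proof (induction n arbitrary: J)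
  case 0
  interpret prob_space \<rho> by fact
  have [measurable]: "cell dx J \<in> sets \<rho>" using cell_borel assms(2) by blast
  have "walk 0 J = indicator (cell dx J)" by (auto simp: measure_return cell_borel)
  then show ?case 
    using emeasure_finite[of "cell dx J"] sets_eq_imp_space_eq[OF assms(2)]
    by (simp add: integrable_indicator_iff less_top del: emeasure_finite)
next
  case (Suc n)
  have "integrable \<rho> (walk n J)" "upwind a dt dx \<rho> n J = (LINT x|\<rho>. walk n J x)" for J
    using Suc by auto
  then show ?case unfolding upwind_Suc_moves
    by (simp add: integrable_mult_right)
qed

text \<open>The jumps are averaged around the mean move first; then \<open>scheme_flow_step\<close>
  compares the mean move with the flow. The additive errors of both are collected in the parameter
  \<open>r\<close> at the earlier time.\<close>

lemma moment_step:
  assumes r: "r \<ge> 0"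
  shows "(\<Sum>z\<in>UNIV. move_prob dt dx (vel n J) z *
       ((norm (grid_point dx (J + index_move z) - Z (real (Suc n) * dt) x))\<^sup>2 + h\<^sup>2 + r) ^ k)
     \<le> exp (4 * integral {real n * dt..real (Suc n) * dt} \<alpha>) ^ k *
        ((norm (grid_point dx J - Z (real n * dt) x))\<^sup>2 + h\<^sup>2 + (error_rate L CARD('d) k * h * dt + r)) ^ k"
proof -
  define s where "s = real n * dt"
  define t where "t = real (Suc n) * dt"
  have st: "0 \<le> s" "s \<le> t" "t - s = dt" using dt by (auto simp: s_def t_def algebra_simps)
  define A where "A = 4 * integral {s..t} \<alpha>"
  have A: "A \<ge> 0" using \<alpha>_integral_nonneg[OF st(1)] by (simp add: A_def)
  define U where "U = (norm (grid_point dx J - Z s x))\<^sup>2 + h\<^sup>2"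
  have U: "U \<ge> 0" by (simp add: U_def)
  define y where "y = grid_point dx J + dt *\<^sub>R (\<chi> i. vel n J i) - Z t x"
  have y: "(norm y)\<^sup>2 + h\<^sup>2 \<le> (1 + A) * U + 8 * L * h * dt"
    using scheme_flow_step[of s t h "grid_point dx J" x] st L_dt_le
    unfolding y_def vel_integral A_def U_def by (simp add: s_def t_def)
  have nn: "moment_const k * (CARD('d) * (L * h * dt)) \<ge> 0"
    using moment_const_pos[of k] L_nonneg h_pos dt by simp
  have rate: "8 * L * h * dt + moment_const k * (CARD('d) * (L * h * dt)) = error_rate L CARD('d) k * h * dt"
    by (simp add: error_rate_def algebra_simps)
  have rate0: "error_rate L CARD('d) k * h * dt \<ge> 0"
    unfolding rate[symmetric] using nn L_nonneg h_pos dt by simp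
  have "(\<Sum>z\<in>UNIV. move_prob dt dx (vel n J) z *
       ((norm (grid_point dx J + space_move dx z - Z t x))\<^sup>2 + h\<^sup>2 + r) ^ k)
     \<le> ((norm y)\<^sup>2 + h\<^sup>2 + r + moment_const k * (CARD('d) * (L * h * dt))) ^ k"
    unfolding y_def by (rule move_moment_le[OF dt dx le_mesh_size norm_vel_le cfl r L_dt_le])
  also have "\<dots> \<le> (exp A * (U + (error_rate L CARD('d) k * h * dt + r))) ^ k"
  proof (rule power_mono)
    have "(norm y)\<^sup>2 + h\<^sup>2 + r + moment_const k * (CARD('d) * (L * h * dt)) \<le> (1 + A) * U + 1 * (error_rate L CARD('d) k * h * dt + r)"
      using y rate by simp
    \<comment> \<open>Besides 1 + A \<le> exp A, the additive errors take the same factor, which can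
      then leave the k-th power.\<close>
    also have "\<dots> \<le> exp A * U + exp A * (error_rate L CARD('d) k * h * dt + r)"
      using U A rate0 r by (intro add_mono mult_right_mono) auto
    finally show "(norm y)\<^sup>2 + h\<^sup>2 + r + moment_const k * (CARD('d) * (L * h * dt)) \<le> exp A * (U + (error_rate L CARD('d) k * h * dt + r))"
      by (simp add: algebra_simps)
  qed (use nn r in simp)
  finally show ?thesis by (simp add: grid_point_add_move U_def A_def s_def t_def power_mult_distrib)
qed

text \<open>The free parameter \<open>r\<close> absorbs the error of each step, which avoids Minkowski's inequality.\<close>

lemma walk_moment_le:
  assumes "r \<ge> 0"
  shows "(\<integral>\<^sup>+J. ennreal (walk n J x) *
      ennreal (((norm (grid_point dx J - Z (real n * dt) x))\<^sup>2 + h\<^sup>2 + r) ^ k) \<partial>count_space UNIV)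
    \<le> ennreal (exp (4 * integral {0..real n * dt} \<alpha>) ^ k * ((CARD('d) + 1) * h\<^sup>2 + n * (error_rate L CARD('d) k * h * dt) + r) ^ k)"
  using assms
proof (induction n arbitrary: r)
  case 0
  \<comment> \<open>The starting node is within squared distance \<open>CARD('d) * h\<^sup>2\<close>
    of \<open>x\<close>; one more \<open>h\<^sup>2\<close> is part of the moment.\<close>
  have "x \<in> cell dx (cell_index dx x)" using in_cell_iff[OF dx] by blast
  from norm_sq_grid_point_cell[OF this dx le_mesh_size] 0 show ?case
    unfolding nn_integral_walk_0 by (auto intro!: ennreal_leI power_mono simp: algebra_simps)
next
  case (Suc n)
  have rate: "error_rate L CARD('d) k * h * dt \<ge> 0" using moment_const_pos[of k] L_nonneg h_pos dt by (simp add: error_rate_def)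
  define E where "E = exp (4 * integral {real n * dt..real (Suc n) * dt} \<alpha>) ^ k"
  have E: "E \<ge> 0" by (simp add: E_def)
  define \<phi> where "\<phi> J = ((norm (grid_point dx J - Z (real n * dt) x))\<^sup>2 + h\<^sup>2 + (error_rate L CARD('d) k * h * dt + r)) ^ k" for J
  have \<phi>: "\<phi> J \<ge> 0" for J using rate Suc.prems by (simp add: \<phi>_def)
  have "(\<integral>\<^sup>+J. ennreal (walk (Suc n) J x) *
      ennreal (((norm (grid_point dx J - Z (real (Suc n) * dt) x))\<^sup>2 + h\<^sup>2 + r) ^ k) \<partial>count_space UNIV)
    \<le> (\<integral>\<^sup>+J. ennreal E * (ennreal (walk n J x) * ennreal (\<phi> J)) \<partial>count_space UNIV)"
    unfolding nn_integral_upwind_Suc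
  proof (rule nn_integral_mono)
    fix J :: "int ^ 'd"
    have "(\<Sum>z\<in>UNIV. ennreal (move_prob dt dx (vel n J) z) *
        ennreal (((norm (grid_point dx (J + index_move z) - Z (real (Suc n) * dt) x))\<^sup>2 + h\<^sup>2 + r) ^ k))
      = ennreal (\<Sum>z\<in>UNIV. move_prob dt dx (vel n J) z *
        ((norm (grid_point dx (J + index_move z) - Z (real (Suc n) * dt) x))\<^sup>2 + h\<^sup>2 + r) ^ k)"
      using Suc.prems by (simp add: walk_prob_nonneg flip: ennreal_mult sum_ennreal)
    also have "\<dots> \<le> ennreal (E * \<phi> J)"
      unfolding E_def \<phi>_def by (intro ennreal_leI moment_step Suc.prems)
    finally have le: "(\<Sum>z\<in>UNIV. ennreal (move_prob dt dx (vel n J) z) *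
        ennreal (((norm (grid_point dx (J + index_move z) - Z (real (Suc n) * dt) x))\<^sup>2 + h\<^sup>2 + r) ^ k))
      \<le> ennreal (E * \<phi> J)" .
    have eq: "ennreal E * (ennreal (walk n J x) * ennreal (\<phi> J)) = ennreal (walk n J x) * ennreal (E * \<phi> J)"
      using E \<phi> by (simp add: ennreal_mult mult.left_commute)
    show "ennreal (walk n J x) * (\<Sum>z\<in>UNIV. ennreal (move_prob dt dx (vel n J) z) *
        ennreal (((norm (grid_point dx (J + index_move z) - Z (real (Suc n) * dt) x))\<^sup>2 + h\<^sup>2 + r) ^ k))
      \<le> ennreal E * (ennreal (walk n J x) * ennreal (\<phi> J))"
      unfolding eq by (rule mult_left_mono[OF le]) simp
  qed
  also have "\<dots> = ennreal E * (\<integral>\<^sup>+J. ennreal (walk n J x) * ennreal (\<phi> J) \<partial>count_space UNIV)"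
    by (simp add: nn_integral_cmult)
  \<comment> \<open>The induction hypothesis is used with \<open>r\<close> enlarged by the error of
    the step, hence the induction over arbitrary \<open>r\<close>.\<close>
  also have "\<dots> \<le> ennreal E * ennreal (exp (4 * integral {0..real n * dt} \<alpha>) ^ k *
      ((CARD('d) + 1) * h\<^sup>2 + n * (error_rate L CARD('d) k * h * dt) + (error_rate L CARD('d) k * h * dt + r)) ^ k)"
    unfolding \<phi>_def using rate Suc.prems by (intro mult_left_mono Suc.IH) auto
  also have "\<dots> = ennreal ((E * exp (4 * integral {0..real n * dt} \<alpha>) ^ k) *
      ((CARD('d) + 1) * h\<^sup>2 + n * (error_rate L CARD('d) k * h * dt) + (error_rate L CARD('d) k * h * dt + r)) ^ k)"
    using E rate Suc.prems by (simp add: ennreal_mult mult.assoc)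
  also have "E * exp (4 * integral {0..real n * dt} \<alpha>) ^ k = exp (4 * integral {0..real (Suc n) * dt} \<alpha>) ^ k"
  proof -
    have "real n * dt \<le> real (Suc n) * dt" using dt by simp
    then have *: "integral {0..real (Suc n) * dt} \<alpha> =
        integral {0..real n * dt} \<alpha> + integral {real n * dt..real (Suc n) * dt} \<alpha>"
      using dt by (intro \<alpha>_integral_combine[symmetric]) simp
    show ?thesis unfolding E_def * distrib_left exp_add power_mult_distrib by (rule mult.commute)
  qed
  also have "(CARD('d) + 1) * h\<^sup>2 + n * (error_rate L CARD('d) k * h * dt) + (error_rate L CARD('d) k * h * dt + r)
     = (CARD('d) + 1) * h\<^sup>2 + Suc n * (error_rate L CARD('d) k * h * dt) + r"
    by (simp add: algebra_simps)
  finally show ?case .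
qed

end

section \<open>The coupling\<close>

lemma wasserstein_le_of_coupling:
  assumes "\<gamma> \<in> couplings \<mu> \<nu>" and c: "(\<integral>\<^sup>+ z. ennreal (norm (fst z - snd z) powr p) \<partial>\<gamma>) \<le> ennreal (b powr p)"
    and p: "p > 0" and b: "b \<ge> 0"
  shows "wasserstein p \<mu> \<nu> \<le> ennreal b"
proof -
  define m where "m = (INF \<gamma>\<in>couplings \<mu> \<nu>. \<integral>\<^sup>+ z. ennreal (norm (fst z - snd z) powr p) \<partial>\<gamma>)"
  have m: "m \<le> ennreal (b powr p)" unfolding m_def
    by (rule INF_lower2[where i = \<gamma>], rule assms(1), rule c)
  then have "enn2real m \<le> b powr p" by (rule enn2real_leI[OF powr_ge_zero])
  then have "enn2real m powr (1 / p) \<le> (b powr p) powr (1 / p)" using p by (intro powr_mono2) auto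
  also have "\<dots> = b" using p b by (simp add: powr_powr)
  finally have "enn2real m powr (1 / p) \<le> b" .
  moreover have "m \<noteq> \<top>" using m by (metis ennreal_less_top less_le_not_le top_greatest)
  ultimately show ?thesis
    unfolding wasserstein_def m_def[symmetric] Let_def by (simp add: ennreal_leI)
qed

context upwind_transport
begin

text \<open>Joint law of the node after \<open>n\<close> steps and the starting point, the latter
  drawn from \<rho>.\<close>

definition walk_measure :: "(real ^ 'd) measure \<Rightarrow> nat \<Rightarrow> ((int ^ 'd) \<times> (real ^ 'd)) measure" where
  "walk_measure \<rho> n = density (count_space UNIV \<Otimes>\<^sub>M \<rho>) (\<lambda>(J, x). ennreal (walk n J x))"

definition walk_coupling :: "(real ^ 'd) measure \<Rightarrow> nat \<Rightarrow> ((real ^ 'd) \<times> (real ^ 'd)) measure" where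
  "walk_coupling \<rho> n =
     distr (walk_measure \<rho> n) (borel \<Otimes>\<^sub>M borel) (\<lambda>(J, x). (Z (real n * dt) x, grid_point dx J))"

text \<open>Tonelli in both orders: at fixed \<open>x\<close> one sums over nodes, for the first
  marginal and the cost; at fixed \<open>J\<close> one averages over \<open>x\<close>, for the
  second marginal. Nodes being countable, joint measurability only has to be checked in
  \<open>x\<close>.\<close>

lemma
  assumes \<rho>: "prob_space \<rho>" "sets \<rho> = sets borel" and f: "f \<in> borel_measurable (borel \<Otimes>\<^sub>M borel)"
  shows nn_integral_walk_coupling: "(\<integral>\<^sup>+z. f z \<partial>walk_coupling \<rho> n) =
      (\<integral>\<^sup>+x. \<integral>\<^sup>+J. ennreal (walk n J x) * f (Z (real n * dt) x, grid_point dx J) \<partial>count_space UNIV \<partial>\<rho>)"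
    and nn_integral_walk_coupling': "(\<integral>\<^sup>+z. f z \<partial>walk_coupling \<rho> n) =
      (\<integral>\<^sup>+J. \<integral>\<^sup>+x. ennreal (walk n J x) * f (Z (real n * dt) x, grid_point dx J) \<partial>\<rho> \<partial>count_space UNIV)"
proof -
  interpret \<rho>: prob_space \<rho> by fact
  interpret C: sigma_finite_measure "count_space (UNIV :: (int ^ 'd) set)"
    by (rule sigma_finite_measure_count_space_countable) simp
  interpret P: pair_sigma_finite "count_space (UNIV :: (int ^ 'd) set)" \<rho> ..
  have [measurable]: "Z (real n * dt) \<in> \<rho> \<rightarrow>\<^sub>M borel"
    using flow_borel_measurable[of "real n * dt"] dt \<rho>(2) measurable_cong_sets by fastforce
  have T: "(\<lambda>(J, x). (Z (real n * dt) x, grid_point dx J)) \<in> count_space UNIV \<Otimes>\<^sub>M \<rho> \<rightarrow>\<^sub>M borel \<Otimes>\<^sub>M borel"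
    by (rule measurable_pair_measure_countable1) auto
  have W: "(\<lambda>(J, x). ennreal (walk n J x)) \<in> count_space UNIV \<Otimes>\<^sub>M \<rho> \<rightarrow>\<^sub>M borel"
  proof (rule measurable_pair_measure_countable1)
    fix J
    have "walk n J \<in> borel_measurable \<rho>"
      using upwind_eq_integral_walk[OF \<rho>, of n J] by (auto intro: borel_measurable_integrable)
    then show "(\<lambda>x. case (J, x) of (J, x) \<Rightarrow> ennreal (walk n J x)) \<in> \<rho> \<rightarrow>\<^sub>M borel" by simp
  qed (rule countableI_type)
  have fT: "(\<lambda>z. case z of (J, x) \<Rightarrow> ennreal (walk n J x) * f (Z (real n * dt) x, grid_point dx J)) \<in>
      borel_measurable (count_space UNIV \<Otimes>\<^sub>M \<rho>)"
    using borel_measurable_times_ennreal[OF W measurable_compose[OF T f]] by (simp only: case_prod_beta)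
  have "(\<integral>\<^sup>+z. f z \<partial>walk_coupling \<rho> n) =
      (\<integral>\<^sup>+z. f (case z of (J, x) \<Rightarrow> (Z (real n * dt) x, grid_point dx J)) \<partial>walk_measure \<rho> n)"
    unfolding walk_coupling_def
  proof (rule nn_integral_distr)
    show "(\<lambda>(J, x). (Z (real n * dt) x, grid_point dx J)) \<in> walk_measure \<rho> n \<rightarrow>\<^sub>M borel \<Otimes>\<^sub>M borel"
      unfolding walk_measure_def measurable_density_eq1 by (rule T)
  qed (unfold measurable_distr_eq1, rule f)
  also have "\<dots> = (\<integral>\<^sup>+z. (case z of (J, x) \<Rightarrow> ennreal (walk n J x)) *
      f (case z of (J, x) \<Rightarrow> (Z (real n * dt) x, grid_point dx J)) \<partial>(count_space UNIV \<Otimes>\<^sub>M \<rho>))"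
    unfolding walk_measure_def by (rule nn_integral_density[OF W]) (rule measurable_compose[OF T f])
  also have "\<dots> = (\<integral>\<^sup>+z. (case z of (J, x) \<Rightarrow> ennreal (walk n J x) *
      f (Z (real n * dt) x, grid_point dx J)) \<partial>(count_space UNIV \<Otimes>\<^sub>M \<rho>))"
    by (simp only: case_prod_beta)
  finally have eq: "(\<integral>\<^sup>+z. f z \<partial>walk_coupling \<rho> n) = (\<integral>\<^sup>+z. (case z of (J, x) \<Rightarrow> ennreal (walk n J x) *
      f (Z (real n * dt) x, grid_point dx J)) \<partial>(count_space UNIV \<Otimes>\<^sub>M \<rho>))" .
  show "(\<integral>\<^sup>+z. f z \<partial>walk_coupling \<rho> n) =
      (\<integral>\<^sup>+x. \<integral>\<^sup>+J. ennreal (walk n J x) * f (Z (real n * dt) x, grid_point dx J) \<partial>count_space UNIV \<partial>\<rho>)"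
    unfolding eq using P.nn_integral_snd[OF fT] by simp
  show "(\<integral>\<^sup>+z. f z \<partial>walk_coupling \<rho> n) =
      (\<integral>\<^sup>+J. \<integral>\<^sup>+x. ennreal (walk n J x) * f (Z (real n * dt) x, grid_point dx J) \<partial>\<rho> \<partial>count_space UNIV)"
    unfolding eq using \<rho>.nn_integral_fst[OF fT] by simp
qed

text \<open>The walk has total mass 1 for each \<open>x\<close>, which leaves the image of \<rho>
  under the flow; averaging the walk over \<open>x\<close> returns the weights of the scheme by
  linearity.\<close>

lemma walk_coupling_in_couplings:
  assumes \<rho>: "prob_space \<rho>" "sets \<rho> = sets borel"
  shows "walk_coupling \<rho> n \<in>
    couplings (Poupaud_Rascle_solution Z \<rho> (real n * dt)) (atomic_measure dx (upwind a dt dx \<rho> n))"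
proof -
  have sets: "sets (walk_coupling \<rho> n) = sets (borel \<Otimes>\<^sub>M borel)" by (simp add: walk_coupling_def)
  have Z [measurable]: "Z (real n * dt) \<in> \<rho> \<rightarrow>\<^sub>M borel"
    using flow_borel_measurable[of "real n * dt"] dt \<rho>(2) measurable_cong_sets by fastforce
  have sp: "space (walk_coupling \<rho> n) = UNIV" by (simp add: walk_coupling_def space_pair_measure)
  have m: "fst \<in> walk_coupling \<rho> n \<rightarrow>\<^sub>M borel" "snd \<in> walk_coupling \<rho> n \<rightarrow>\<^sub>M borel"
    using measurable_cong_sets[OF sets refl] by auto
  have "distr (walk_coupling \<rho> n) borel fst = distr \<rho> borel (Z (real n * dt))"
  proof (rule measure_eqI)
    fix B :: "(real ^ 'd) set" assume "B \<in> sets (distr (walk_coupling \<rho> n) borel fst)"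
    then have B [measurable]: "B \<in> sets borel" by simp
    have "emeasure (distr (walk_coupling \<rho> n) borel fst) B = (\<integral>\<^sup>+y. indicator B y \<partial>distr (walk_coupling \<rho> n) borel fst)"
      using B by (simp add: nn_integral_indicator)
    also have "\<dots> = (\<integral>\<^sup>+z. indicator B (fst z) \<partial>walk_coupling \<rho> n)"
      by (rule nn_integral_distr[OF m(1)]) simp
    also have "\<dots> = (\<integral>\<^sup>+x. \<integral>\<^sup>+J. ennreal (walk n J x) * indicator B (Z (real n * dt) x) \<partial>count_space UNIV \<partial>\<rho>)"
      by (subst nn_integral_walk_coupling[OF \<rho>]) auto
    also have "\<dots> = (\<integral>\<^sup>+x. indicator B (Z (real n * dt) x) \<partial>\<rho>)"
      by (simp add: nn_integral_multc nn_integral_walk)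
    also have "\<dots> = (\<integral>\<^sup>+y. indicator B y \<partial>distr \<rho> borel (Z (real n * dt)))"
      by (rule nn_integral_distr[symmetric, OF Z]) simp
    also have "\<dots> = emeasure (distr \<rho> borel (Z (real n * dt))) B"
      using B by (simp add: nn_integral_indicator)
    finally show "emeasure (distr (walk_coupling \<rho> n) borel fst) B = emeasure (distr \<rho> borel (Z (real n * dt))) B" .
  qed simp
  moreover have "distr (walk_coupling \<rho> n) borel snd = atomic_measure dx (upwind a dt dx \<rho> n)"
  proof (rule measure_eqI)
    fix B :: "(real ^ 'd) set" assume "B \<in> sets (distr (walk_coupling \<rho> n) borel snd)"
    then have B [measurable]: "B \<in> sets borel" by simp
    have "emeasure (distr (walk_coupling \<rho> n) borel snd) B = (\<integral>\<^sup>+y. indicator B y \<partial>distr (walk_coupling \<rho> n) borel snd)"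
      using B by (simp add: nn_integral_indicator)
    also have "\<dots> = (\<integral>\<^sup>+z. indicator B (snd z) \<partial>walk_coupling \<rho> n)"
      by (rule nn_integral_distr[OF m(2)]) simp
    also have "\<dots> = (\<integral>\<^sup>+J. \<integral>\<^sup>+x. ennreal (walk n J x) * indicator B (grid_point dx J) \<partial>\<rho> \<partial>count_space UNIV)"
      by (subst nn_integral_walk_coupling'[OF \<rho>]) auto
    also have "\<dots> = (\<integral>\<^sup>+J. ennreal (upwind a dt dx \<rho> n J) * indicator B (grid_point dx J) \<partial>count_space UNIV)"
    proof (rule nn_integral_cong)
      fix J
      have i: "integrable \<rho> (walk n J)" "upwind a dt dx \<rho> n J = (LINT x|\<rho>. walk n J x)"
        using upwind_eq_integral_walk[OF \<rho>, of n J] by auto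
      have "(\<integral>\<^sup>+x. ennreal (walk n J x) \<partial>\<rho>) = ennreal (upwind a dt dx \<rho> n J)"
        unfolding i(2) by (rule nn_integral_eq_integral[OF i(1)]) (simp add: upwind_nonneg)
      then show "(\<integral>\<^sup>+x. ennreal (walk n J x) * indicator B (grid_point dx J) \<partial>\<rho>)
          = ennreal (upwind a dt dx \<rho> n J) * indicator B (grid_point dx J)"
        using borel_measurable_integrable[OF i(1)] by (simp add: nn_integral_multc)
    qed
    also have "\<dots> = (\<integral>\<^sup>+y. indicator B y \<partial>atomic_measure dx (upwind a dt dx \<rho> n))"
    proof -
      have "(\<integral>\<^sup>+y. indicator B y \<partial>atomic_measure dx (upwind a dt dx \<rho> n)) = (\<integral>\<^sup>+J. indicator B (grid_point dx J)
          \<partial>density (count_space UNIV) (\<lambda>J. ennreal (upwind a dt dx \<rho> n J)))"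
        unfolding atomic_measure_def by (rule nn_integral_distr) auto
      then show ?thesis by (subst (asm) nn_integral_density) auto
    qed
    also have "\<dots> = emeasure (atomic_measure dx (upwind a dt dx \<rho> n)) B"
      using B by (simp add: nn_integral_indicator atomic_measure_def)
    finally show "emeasure (distr (walk_coupling \<rho> n) borel snd) B = emeasure (atomic_measure dx (upwind a dt dx \<rho> n)) B" .
  qed (simp add: atomic_measure_def)
  ultimately show ?thesis by (simp add: couplings_def Poupaud_Rascle_solution_def sets)
qed

text \<open>A substitute for Jensen's inequality: in units of \<open>B\<close> the moment of order
  2k is at most 1, so s^p \<le> 1 + s^(2k) bounds the cost by 2 B^p. As p \<ge> 1, this is at most
  (2 B)^p, the origin of the factor 2.\<close>

lemma wasserstein_upwind_le:
  assumes \<rho>: "prob_space \<rho>" "sets \<rho> = sets borel" and p: "p \<ge> 1" and k: "p \<le> 2 * real k"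
  shows "wasserstein p (Poupaud_Rascle_solution Z \<rho> (real n * dt)) (atomic_measure dx (upwind a dt dx \<rho> n))
    \<le> ennreal (2 * sqrt (CARD('d) + 1 + error_rate L CARD('d) k) * exp (2 * integral {0..real n * dt} \<alpha>) *
        (sqrt (real n * dt * h) + h))"
proof -
  define t where "t = real n * dt"
  define e where "e = error_rate L CARD('d) k"
  have e: "e \<ge> 0" using moment_const_pos[of k] L_nonneg by (simp add: e_def error_rate_def)
  define D where "D = (CARD('d) + 1) * h\<^sup>2 + n * (e * h * dt)"
  have th: "t \<ge> 0" "t * h \<ge> 0" using dt h_pos by (auto simp: t_def)
  have ed: "0 \<le> e * h * dt" using e h_pos dt by simp
  have D: "D > 0" unfolding D_def using h_pos ed by (intro add_pos_nonneg mult_pos_pos) auto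
  \<comment> \<open>\<open>B\<close> is the 2k-th root of the bound in \<open>walk_moment_le\<close>
    at \<open>r = 0\<close>.\<close>
  define B where "B = exp (2 * integral {0..t} \<alpha>) * sqrt D"
  have B: "B > 0" using D by (simp add: B_def)
  have B2: "(B\<^sup>2) ^ k = exp (4 * integral {0..t} \<alpha>) ^ k * D ^ k"
    using D by (simp add: B_def power_mult_distrib flip: exp_double)
  have sq: "(CARD('d) + 1) * S\<^sup>2 + e * S\<^sup>2 = (sqrt (CARD('d) + 1 + e) * S)\<^sup>2" for S :: real
    using e by (simp add: power_mult_distrib algebra_simps)
  \<comment> \<open>Both h^2 and t h are at most (sqrt(t h) + h)^2; here the shape of the rate
    arises.\<close>
  have DB: "sqrt D \<le> sqrt (CARD('d) + 1 + e) * (sqrt (t * h) + h)"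
  proof (rule real_le_lsqrt)
    have "D = (CARD('d) + 1) * h\<^sup>2 + e * (sqrt (t * h))\<^sup>2"
      using th by (simp add: D_def t_def algebra_simps)
    also have "\<dots> \<le> (CARD('d) + 1) * (sqrt (t * h) + h)\<^sup>2 + e * (sqrt (t * h) + h)\<^sup>2"
      using e h_pos th by (intro add_mono mult_left_mono power_mono) auto
    also have "\<dots> = (sqrt (CARD('d) + 1 + e) * (sqrt (t * h) + h))\<^sup>2" by (rule sq)
    finally show "D \<le> (sqrt (CARD('d) + 1 + e) * (sqrt (t * h) + h))\<^sup>2" .
  qed (use D e h_pos th in auto)
  \<comment> \<open>The summand 0 stands for the parameter \<open>r\<close> of
    \<open>walk_moment_le\<close>.\<close>
  have pt: "ennreal (norm w powr p) \<le> ennreal (B powr p) * (1 + ennreal (1 / (B\<^sup>2) ^ k) * ennreal (((norm w)\<^sup>2 + h\<^sup>2 + 0) ^ k))"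
    for w :: "real ^ 'd"
  proof -
    define s where "s = norm w / B"
    have s: "s \<ge> 0" using B by (simp add: s_def)
    have "s powr p \<le> 1 + s ^ (2 * k)"
    proof (cases "s \<le> 1")
      case True
      then have "s powr p \<le> 1" using s p by (simp add: powr_le1)
      then show ?thesis using s by (simp add: add_increasing2)
    next
      case False
      then have "s powr p \<le> s powr real (2 * k)" using k by (intro powr_mono) auto
      also have "\<dots> = s ^ (2 * k)" using False by (simp add: powr_realpow del: of_nat_mult)
      finally show ?thesis by simp
    qed
    moreover have "norm w powr p = B powr p * s powr p"
      using B s by (simp add: s_def flip: powr_mult)
    moreover have "s ^ (2 * k) = 1 / (B\<^sup>2) ^ k * ((norm w)\<^sup>2) ^ k"
      by (simp add: s_def power_mult power_divide)
    moreover have "1 / (B\<^sup>2) ^ k * ((norm w)\<^sup>2) ^ k \<le> 1 / (B\<^sup>2) ^ k * ((norm w)\<^sup>2 + h\<^sup>2 + 0) ^ k"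
      by (intro mult_left_mono power_mono) auto
    ultimately have "norm w powr p \<le> B powr p * (1 + 1 / (B\<^sup>2) ^ k * ((norm w)\<^sup>2 + h\<^sup>2 + 0) ^ k)"
      by (simp add: mult_left_mono)
    from ennreal_leI[OF this] have "ennreal (norm w powr p) \<le> ennreal (B powr p * (1 + 1 / (B\<^sup>2) ^ k * ((norm w)\<^sup>2 + h\<^sup>2 + 0) ^ k))" .
    moreover have "ennreal (B powr p * (1 + q * q')) = ennreal (B powr p) * (1 + ennreal q * ennreal q')"
      if "q \<ge> 0" "q' \<ge> 0" for q q' :: real
      using that by (simp add: ennreal_mult)
    ultimately show ?thesis by (simp only: zero_le_divide_1_iff zero_le_power zero_le_power2 add_nonneg_nonneg order_refl)
  qed
  interpret \<rho>: prob_space \<rho> by fact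
  have "(\<integral>\<^sup>+ z. ennreal (norm (fst z - snd z) powr p) \<partial>walk_coupling \<rho> n) =
     (\<integral>\<^sup>+x. \<integral>\<^sup>+J. ennreal (walk n J x) * ennreal (norm (Z t x - grid_point dx J) powr p) \<partial>count_space UNIV \<partial>\<rho>)"
    by (subst nn_integral_walk_coupling[OF \<rho>]) (auto simp: t_def)
  also have "\<dots> \<le> (\<integral>\<^sup>+x. ennreal (B powr p) * 2 \<partial>\<rho>)"
  proof (rule nn_integral_mono)
    fix x
    define \<psi> where "\<psi> J = ennreal (((norm (grid_point dx J - Z t x))\<^sup>2 + h\<^sup>2 + 0) ^ k)" for J
    have "(\<integral>\<^sup>+J. ennreal (walk n J x) * ennreal (norm (Z t x - grid_point dx J) powr p) \<partial>count_space UNIV)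
      \<le> (\<integral>\<^sup>+J. ennreal (B powr p) * (ennreal (walk n J x) + ennreal (1 / (B\<^sup>2) ^ k) * (ennreal (walk n J x) * \<psi> J)) \<partial>count_space UNIV)"
    proof (rule nn_integral_mono)
      fix J
      have "ennreal (norm (Z t x - grid_point dx J) powr p) \<le> ennreal (B powr p) * (1 + ennreal (1 / (B\<^sup>2) ^ k) * \<psi> J)"
        unfolding \<psi>_def using pt[of "grid_point dx J - Z t x"] by (simp only: norm_minus_commute)
      then have "ennreal (walk n J x) * ennreal (norm (Z t x - grid_point dx J) powr p) \<le>
          ennreal (walk n J x) * (ennreal (B powr p) * (1 + ennreal (1 / (B\<^sup>2) ^ k) * \<psi> J))"
        by (rule mult_left_mono) simp
      also have "\<dots> = ennreal (B powr p) * (ennreal (walk n J x) + ennreal (1 / (B\<^sup>2) ^ k) * (ennreal (walk n J x) * \<psi> J))"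
        by (simp only: distrib_left mult_1_right mult_1_left mult_ac)
      finally show "ennreal (walk n J x) * ennreal (norm (Z t x - grid_point dx J) powr p) \<le>
          ennreal (B powr p) * (ennreal (walk n J x) + ennreal (1 / (B\<^sup>2) ^ k) * (ennreal (walk n J x) * \<psi> J))" .
    qed
    also have "\<dots> = ennreal (B powr p) * (1 + ennreal (1 / (B\<^sup>2) ^ k) *
        (\<integral>\<^sup>+J. ennreal (walk n J x) * \<psi> J \<partial>count_space UNIV))"
      by (simp add: nn_integral_cmult nn_integral_add nn_integral_walk)
    also have "\<dots> \<le> ennreal (B powr p) * (1 + ennreal (1 / (B\<^sup>2) ^ k) * ennreal ((B\<^sup>2) ^ k))"
      using walk_moment_le[where r = 0 and n = n and x = x and k = k]
      by (intro mult_left_mono add_left_mono) (simp_all add: \<psi>_def B2 t_def D_def e_def)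
    also have "ennreal (1 / (B\<^sup>2) ^ k) * ennreal ((B\<^sup>2) ^ k) = 1"
      using B by (simp flip: ennreal_mult)
    finally show "(\<integral>\<^sup>+J. ennreal (walk n J x) * ennreal (norm (Z t x - grid_point dx J) powr p) \<partial>count_space UNIV)
       \<le> ennreal (B powr p) * 2" by simp
  qed
  also have "\<dots> = ennreal (B powr p * 2)" by (simp add: \<rho>.emeasure_space_1 ennreal_mult)
  also have "\<dots> \<le> ennreal ((2 * B) powr p)"
  proof (rule ennreal_leI)
    have "2 powr 1 \<le> (2::real) powr p" using p by (intro powr_mono) auto
    then show "B powr p * 2 \<le> (2 * B) powr p" using B by (simp add: powr_mult mult.commute mult_left_mono)
  qed
  finally have "wasserstein p (Poupaud_Rascle_solution Z \<rho> (real n * dt)) (atomic_measure dx (upwind a dt dx \<rho> n))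
    \<le> ennreal (2 * B)"
    using p B by (intro wasserstein_le_of_coupling[OF walk_coupling_in_couplings[OF \<rho>]]) auto
  also have "\<dots> \<le> ennreal (2 * sqrt (CARD('d) + 1 + e) * exp (2 * integral {0..t} \<alpha>) * (sqrt (t * h) + h))"
    using mult_left_mono[OF DB, of "2 * exp (2 * integral {0..t} \<alpha>)"] by (intro ennreal_leI) (simp add: B_def mult_ac)
  finally show ?thesis by (simp add: t_def e_def)
qed

end

theorem theorem4p1:
  fixes p a_inf :: real and \<rho>ini :: "(real ^ 'd) measure"
  assumes "p \<ge> 1" and "\<rho>ini \<in> finite_moment_measures p"
  shows "\<exists>C\<ge>0. \<forall>(a :: real \<Rightarrow> real ^ 'd \<Rightarrow> real ^ 'd) (\<alpha> :: real \<Rightarrow> real)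
            (Z :: real \<Rightarrow> real ^ 'd \<Rightarrow> real ^ 'd) (dt :: real) (dx :: real ^ 'd).
     jointly_measurable a \<longrightarrow>
     Linf_norm a = ereal a_inf \<longrightarrow>
     (\<forall>t\<ge>0. \<alpha> t \<ge> 0) \<longrightarrow>
     L1_loc \<alpha> \<longrightarrow>
     one_sided_Lipschitz a \<alpha> \<longrightarrow>
     Filippov_flow a Z \<longrightarrow>
     dt > 0 \<longrightarrow>
     (\<forall>i. dx $ i > 0) \<longrightarrow>
     mesh_size dx \<le> 1 \<longrightarrow>
     a_inf * (\<Sum>i\<in>UNIV. dt / dx $ i) \<le> 1 \<longrightarrow>
     (\<forall>n\<ge>1. wasserstein p (Poupaud_Rascle_solution Z \<rho>ini (real n * dt))
                           (atomic_measure dx (upwind a dt dx \<rho>ini n))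
        \<le> ennreal (C * exp (2 * (LINT s:{0..real n * dt}|lebesgue. \<alpha> s))
                      * (sqrt (real n * dt * mesh_size dx) + mesh_size dx)))"
proof -
  \<comment> \<open>An order fixed by \<open>p\<close> alone, so that the constant is chosen before
    the velocity field and the mesh.\<close>
  define k where "k = nat \<lceil>p\<rceil>"
  have k: "p \<le> 2 * real k" using assms(1) unfolding k_def by linarith
  have \<rho>: "prob_space \<rho>ini" "sets \<rho>ini = sets borel"
    using assms(2) by (auto simp: finite_moment_measures_def)
  define C where "C = 2 * sqrt (CARD('d) + 1 + error_rate a_inf CARD('d) k)"
  show ?thesis
  \<comment> \<open>The constant is named before the hypotheses on the field are available, and
    without them \<open>a_inf\<close> may be negative. Once they hold, \<open>C \<ge> 0\<close> and
    the absolute value disappears.\<close>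
  proof (intro exI[of _ "\<bar>C\<bar>"] conjI allI impI)
    fix a :: "real \<Rightarrow> real ^ 'd \<Rightarrow> real ^ 'd" and \<alpha> Z dt and dx :: "real ^ 'd" and n :: nat
    assume "jointly_measurable a" "Linf_norm a = ereal a_inf" "\<forall>t\<ge>0. \<alpha> t \<ge> 0" "L1_loc \<alpha>"
      "one_sided_Lipschitz a \<alpha>" "Filippov_flow a Z" "dt > 0" "\<forall>i. dx $ i > 0"
      "a_inf * (\<Sum>i\<in>UNIV. dt / dx $ i) \<le> 1"
    then interpret upwind_transport a \<alpha> Z a_inf dt dx by unfold_locales auto
    have "(LINT s:{0..real n * dt}|lebesgue. \<alpha> s) = integral {0..real n * dt} \<alpha>"
      using dt by (intro set_lebesgue_integral_eq_integral \<alpha>_set_integrable) simp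
    moreover have "C \<ge> 0"
      using moment_const_pos[of k] L_nonneg by (simp add: C_def error_rate_def)
    ultimately show "wasserstein p (Poupaud_Rascle_solution Z \<rho>ini (real n * dt)) (atomic_measure dx (upwind a dt dx \<rho>ini n))
        \<le> ennreal (\<bar>C\<bar> * exp (2 * (LINT s:{0..real n * dt}|lebesgue. \<alpha> s))
                      * (sqrt (real n * dt * mesh_size dx) + mesh_size dx))"
      using wasserstein_upwind_le[OF \<rho> assms(1) k, of n] by (simp add: C_def)
  qed simp
qed

end
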